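(* Suppose that $A$ and $S$ are lattices in $\mathbb{R}^k$ and $\mathbb{R}^n$, respectively. (i) (A change in the discount factor) Suppose that $r$ is supermodular in $(s,a)$ and increasing in $s$, $p$ is increasing and supermodular in $(s,a)$, $\Gamma$ is supermodular, and $\Gamma(s_1)\subseteq\Gamma(s_2)$ whenever $s_1\le s_2$. For $\beta\in(0,1)$ let $V(\cdot,\beta)$ be the value function when the discount factor is $\beta$ and let $G(s,\beta)=\operatorname{argmax}_{a\in\Gamma(s)}\, r(s,a)+\beta\int_S V(s',\beta)p(s,a,ds')$. Then $G(s,\beta)$ is ascending (as a correspondence on $S\times(0,1)$ with the product order). (ii) (A parameter that influences the payoff function) Let $E$ be a partially ordered set, let $c\in E$ be a parameter that influences the payoff function, and write $r(s,a,c)$ instead of $r(s,a)$. Suppose that $r$ is supermodular in $(s,a)$ and has increasing differences in $(s,a,c)$, $p$ is increasing and supermodular in $(s,a)$, and $\Gamma$ is supermodular. With the discount factor $\beta\in(0,1)$ fixed, let $V(\cdot,c)$ be the value function when the payoff is $r(\cdot,\cdot,c)$ and let $G(s,c)=\operatorname{argmax}_{a\in\Gamma(s)}\, r(s,a,c)+\beta\int_S V(s',c)p(s,a,ds')$. Then $G(s,c)$ is ascending (as a correspondence on $S\times E$ with the product order).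
   Context: Discounted dynamic programming model (infinite horizon). $S\subseteq\mathbb{R}^n$ (states, a separable complete metric space) and $A\subseteq\mathbb{R}^k$ (actions) are measurable (measurable means Borel), with the product order. $\Gamma:S\to2^A$ gives the feasible actions. $p(s,a,\cdot)$ is a probability measure on $S$ for each $(s,a)\in S\times A$, with $p(\cdot,\cdot,B)$ measurable for each Borel $B$. $r:S\times A\to\mathbb{R}$ is the measurable payoff and $\beta\in(0,1)$ the discount factor. Strategies: $\sigma=(\sigma_t)_{t\ge1}$ with $\sigma_t:S\times(A\times S)^{t-1}\to A$ Borel measurable and $\sigma_t(s(1),a(1),\dots,s(t))\in\Gamma(s(t))$. With initial state $s(1)=s$, $V_\sigma(s)=\mathbb{E}_\sigma\sum_{t=1}^\infty\beta^{t-1}r(s(t),a(t))$, where $\mathbb{E}_\sigma$ is the expectation for the process generated by $\sigma$ and $p$; the value function is $\sup_\sigma V_\sigma(s)$. Standing assumptions (in (ii), for each value of the parameter $c$): $r$ is bounded and u.s.c. (upper semi-continuous) in $(s,a)$; $p$ is u.s.c., i.e., $(s,a)\mapsto\int f(s')p(s,a,ds')$ is u.s.c. and bounded whenever $f:S\to\mathbb{R}$ is u.s.c. and bounded; $\Gamma$ is u.s.c., i.e., $\{s:\Gamma(s)\subseteq U\}$ is open whenever $U\subseteq A$ is open; $\Gamma(s)$ is nonempty and compact for each $s$. (Under these, the value function $V$ is the unique bounded u.s.c. solution of $V(s)=\max_{a\in\Gamma(s)}[r(s,a)+\beta\int V(s')p(s,a,ds')]$.) Definitions: a lattice in $\mathbb{R}^m$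 is a subset closed under componentwise maximum $\lor$ and minimum $\land$. $f:X\to\mathbb{R}$ on a lattice is supermodular if $f(x)+f(x')\le f(x\lor x')+f(x\land x')$ for all $x,x'\in X$. $f$ is increasing if $x\ge y$ implies $f(x)\ge f(y)$. $p$ is increasing (resp. supermodular) if $g(s,a)=\int f(s')p(s,a,ds')$ is increasing in $(s,a)$ (resp. supermodular on $S\times A$) whenever $f:S\to\mathbb{R}$ is increasing (resp. supermodular), for measurable $f$ with integrals defined. $\Gamma$ is supermodular if $a'\in\Gamma(s')$, $a''\in\Gamma(s'')$ imply $a'\lor a''\in\Gamma(s'\lor s'')$ and $a'\land a''\in\Gamma(s'\land s'')$. For partially ordered $X,E$, $f:X\times E\to\mathbb{R}$ has increasing differences in $(x,e)$ if $f(x_2,e_2)-f(x_2,e_1)\ge f(x_1,e_2)-f(x_1,e_1)$ whenever $x_2\ge x_1$ and $e_2\succeq e_1$; increasing differences in $(s,a,c)$ means increasing differences in each pair $(s,a)$, $(s,c)$, $(a,c)$. A correspondence $G$ from a partially ordered set $Y$ into subsets of a lattice is ascending if $y_2\ge y_1$, $x\in G(y_2)$, $x'\in G(y_1)$ imply $x\lor x'\in G(y_2)$ and $x\land x'\in G(y_1)$. *)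

theory Defs
  imports "HOL-Probability.Probability"
begin

text \<open>
  Euclidean space carries the componentwise order, with componentwise \<^const>\<open>sup\<close> and
  \<^const>\<open>inf\<close>, and pairs are ordered componentwise, so the order notions below apply uniformly
  to states, actions and state-action pairs.
\<close>

definition lattice_set :: "'a::lattice set \<Rightarrow> bool" where
  "lattice_set X \<longleftrightarrow> (\<forall>x\<in>X. \<forall>y\<in>X. sup x y \<in> X \<and> inf x y \<in> X)"

definition supermodular_on :: "'a::lattice set \<Rightarrow> ('a \<Rightarrow> real) \<Rightarrow> bool" where
  "supermodular_on X f \<longleftrightarrow> (\<forall>x\<in>X. \<forall>y\<in>X. f x + f y \<le> f (sup x y) + f (inf x y))"

definition increasing_differences ::
    "'x::order set \<Rightarrow> 'e::order set \<Rightarrow> ('x \<Rightarrow> 'e \<Rightarrow> real) \<Rightarrow> bool" where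
  "increasing_differences X E f \<longleftrightarrow>
     (\<forall>x1\<in>X. \<forall>x2\<in>X. \<forall>e1\<in>E. \<forall>e2\<in>E. x1 \<le> x2 \<longrightarrow> e1 \<le> e2 \<longrightarrow>
        f x1 e2 - f x1 e1 \<le> f x2 e2 - f x2 e1)"

definition increasing_differences3 ::
    "'x::order set \<Rightarrow> 'y::order set \<Rightarrow> 'e::order set \<Rightarrow> ('x \<Rightarrow> 'y \<Rightarrow> 'e \<Rightarrow> real) \<Rightarrow> bool" where
  "increasing_differences3 X Y E f \<longleftrightarrow>
     (\<forall>e\<in>E. increasing_differences X Y (\<lambda>x y. f x y e)) \<and>
     (\<forall>y\<in>Y. increasing_differences X E (\<lambda>x e. f x y e)) \<and>
     (\<forall>x\<in>X. increasing_differences Y E (\<lambda>y e. f x y e))"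

definition supermodular_corr :: "'s::lattice set \<Rightarrow> ('s \<Rightarrow> 'a::lattice set) \<Rightarrow> bool" where
  "supermodular_corr S \<Gamma> \<longleftrightarrow>
     (\<forall>s1\<in>S. \<forall>s2\<in>S. \<forall>a1\<in>\<Gamma> s1. \<forall>a2\<in>\<Gamma> s2.
        sup a1 a2 \<in> \<Gamma> (sup s1 s2) \<and> inf a1 a2 \<in> \<Gamma> (inf s1 s2))"

definition ascending_on :: "'y::order set \<Rightarrow> ('y \<Rightarrow> 'x::lattice set) \<Rightarrow> bool" where
  "ascending_on Y G \<longleftrightarrow>
     (\<forall>y1\<in>Y. \<forall>y2\<in>Y. y1 \<le> y2 \<longrightarrow>
        (\<forall>x\<in>G y2. \<forall>x'\<in>G y1. sup x x' \<in> G y2 \<and> inf x x' \<in> G y1))"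

definition usc_on :: "'a::topological_space set \<Rightarrow> ('a \<Rightarrow> real) \<Rightarrow> bool" where
  "usc_on X f \<longleftrightarrow> (\<forall>t. openin (top_of_set X) {x\<in>X. f x < t})"

definition usc_corr ::
    "'s::topological_space set \<Rightarrow> 'a::topological_space set \<Rightarrow> ('s \<Rightarrow> 'a set) \<Rightarrow> bool" where
  "usc_corr S A \<Gamma> \<longleftrightarrow>
     (\<forall>U. openin (top_of_set A) U \<longrightarrow> openin (top_of_set S) {s\<in>S. \<Gamma> s \<subseteq> U})"

abbreviation borel_on :: "'a::topological_space set \<Rightarrow> 'a measure" where
  "borel_on X \<equiv> restrict_space borel X"

type_synonym ('s, 'a) kernel = "'s \<times> 'a \<Rightarrow> 's measure"

definition usc_kernel ::
    "'s::topological_space set \<Rightarrow> 'a::topological_space set \<Rightarrow> ('s, 'a) kernel \<Rightarrow> bool" where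
  "usc_kernel S A p \<longleftrightarrow>
     (\<forall>f. usc_on S f \<and> bounded (f ` S) \<longrightarrow>
        usc_on (S \<times> A) (\<lambda>x. LINT s'|p x. f s') \<and>
        bounded ((\<lambda>x. LINT s'|p x. f s') ` (S \<times> A)))"

definition integrable_for_kernel ::
    "'s::topological_space set \<Rightarrow> 'a set \<Rightarrow> ('s, 'a) kernel \<Rightarrow> ('s \<Rightarrow> real) \<Rightarrow> bool" where
  "integrable_for_kernel S A p f \<longleftrightarrow>
     f \<in> borel_measurable (borel_on S) \<and> (\<forall>x\<in>S \<times> A. integrable (p x) f)"

definition increasing_kernel ::
    "'s::{topological_space, order} set \<Rightarrow> 'a::order set \<Rightarrow> ('s, 'a) kernel \<Rightarrow> bool" where
  "increasing_kernel S A p \<longleftrightarrow>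
     (\<forall>f. mono_on S f \<and> integrable_for_kernel S A p f \<longrightarrow>
        mono_on (S \<times> A) (\<lambda>x. LINT s'|p x. f s'))"

definition supermodular_kernel ::
    "'s::{topological_space, lattice} set \<Rightarrow> 'a::lattice set \<Rightarrow> ('s, 'a) kernel \<Rightarrow> bool" where
  "supermodular_kernel S A p \<longleftrightarrow>
     (\<forall>f. supermodular_on S f \<and> integrable_for_kernel S A p f \<longrightarrow>
        supermodular_on (S \<times> A) (\<lambda>x. LINT s'|p x. f s'))"

text \<open>
  \<^const>\<open>prob_algebra\<close> makes \<open>p\<close> a probability kernel: each \<open>p (s, a)\<close> is a probability measure
  on the Borel sets of \<open>S\<close>, and \<open>(s, a) \<mapsto> p (s, a) B\<close> is measurable for each Borel \<open>B \<subseteq> S\<close>.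
\<close>

locale dynamic_program =
  fixes S :: "(real ^ 'n) set"
    and A :: "(real ^ 'k) set"
    and \<Gamma> :: "(real ^ 'n) \<Rightarrow> (real ^ 'k) set"
    and p :: "(real ^ 'n, real ^ 'k) kernel"
    and r :: "(real ^ 'n) \<times> (real ^ 'k) \<Rightarrow> real"
  assumes states_borel: "S \<in> sets borel"
    and states_complete: "Topological_Spaces.complete S"
    and actions_borel: "A \<in> sets borel"
    and feasible_subset: "s \<in> S \<Longrightarrow> \<Gamma> s \<subseteq> A"
    and feasible_nonempty: "s \<in> S \<Longrightarrow> \<Gamma> s \<noteq> {}"
    and feasible_compact: "s \<in> S \<Longrightarrow> compact (\<Gamma> s)"
    and feasible_usc: "usc_corr S A \<Gamma>"
    and kernel: "p \<in> borel_on (S \<times> A) \<rightarrow>\<^sub>M prob_algebra (borel_on S)"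
    and kernel_usc: "usc_kernel S A p"
    and payoff_measurable: "r \<in> borel_measurable (borel_on (S \<times> A))"
    and payoff_bounded: "bounded (r ` (S \<times> A))"
    and payoff_usc: "usc_on (S \<times> A) r"

text \<open>
  Time is counted from \<open>0\<close>. At time \<open>t\<close> the history \<open>(s\<^sub>0, a\<^sub>0, \<dots>, a\<^bsub>t-1\<^esub>, s\<^sub>t)\<close> is split into the
  past pairs \<open>h i = (s\<^sub>i, a\<^sub>i)\<close>, \<open>i < t\<close>, and the current state, so that \<open>\<sigma> t h s\<close> is the action
  taken at time \<open>t\<close>.
\<close>

type_synonym ('s, 'a) strategy = "nat \<Rightarrow> (nat \<Rightarrow> 's \<times> 'a) \<Rightarrow> 's \<Rightarrow> 'a"

definition strategies ::
    "'s::topological_space set \<Rightarrow> 'a::topological_space set \<Rightarrow> ('s \<Rightarrow> 'a set) \<Rightarrow> ('s, 'a) strategy set"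
  where
  "strategies S A \<Gamma> = {\<sigma>. \<forall>t.
     (\<lambda>(h, s). \<sigma> t h s)
       \<in> (\<Pi>\<^sub>M i\<in>{0..<t}. borel_on (S \<times> A)) \<Otimes>\<^sub>M borel_on S \<rightarrow>\<^sub>M borel_on A \<and>
     (\<forall>h\<in>{0..<t} \<rightarrow>\<^sub>E S \<times> A. \<forall>s\<in>S. \<sigma> t h s \<in> \<Gamma> s)}"

text \<open>Conditional law of the state-action pair at time \<open>t\<close> given the past pairs.\<close>

definition step_law ::
    "'s::topological_space set \<Rightarrow> 'a::topological_space set \<Rightarrow> ('s, 'a) kernel \<Rightarrow>
     ('s, 'a) strategy \<Rightarrow> 's \<Rightarrow> nat \<Rightarrow> (nat \<Rightarrow> 's \<times> 'a) \<Rightarrow> ('s \<times> 'a) measure" where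
  "step_law S A p \<sigma> s t h =
     distr (case t of 0 \<Rightarrow> return (borel_on S) s | Suc u \<Rightarrow> p (h u))
       (borel_on (S \<times> A)) (\<lambda>s'. (s', \<sigma> t h s'))"

text \<open>
  Law of the whole path \<open>(s\<^sub>t, a\<^sub>t)\<^sub>t\<close> started in \<open>s\<close>: the projective limit supplied by the
  Ionescu Tulcea theorem for the conditional laws above.
\<close>

definition process ::
    "'s::topological_space set \<Rightarrow> 'a::topological_space set \<Rightarrow> ('s, 'a) kernel \<Rightarrow>
     ('s, 'a) strategy \<Rightarrow> 's \<Rightarrow> (nat \<Rightarrow> 's \<times> 'a) measure" where
  "process S A p \<sigma> s =
     projective_family.lim UNIV
       (Ionescu_Tulcea.CI (step_law S A p \<sigma> s) (\<lambda>_. borel_on (S \<times> A)))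
       (\<lambda>_. borel_on (S \<times> A))"

definition payoff ::
    "'s::topological_space set \<Rightarrow> 'a::topological_space set \<Rightarrow> ('s, 'a) kernel \<Rightarrow>
     ('s \<times> 'a \<Rightarrow> real) \<Rightarrow> real \<Rightarrow> ('s, 'a) strategy \<Rightarrow> 's \<Rightarrow> real" where
  "payoff S A p r \<beta> \<sigma> s = (LINT \<omega>|process S A p \<sigma> s. (\<Sum>t. \<beta> ^ t * r (\<omega> t)))"

definition value_fun ::
    "'s::topological_space set \<Rightarrow> 'a::topological_space set \<Rightarrow> ('s \<Rightarrow> 'a set) \<Rightarrow> ('s, 'a) kernel \<Rightarrow>
     ('s \<times> 'a \<Rightarrow> real) \<Rightarrow> real \<Rightarrow> 's \<Rightarrow> real" where
  "value_fun S A \<Gamma> p r \<beta> s = (SUP \<sigma>\<in>strategies S A \<Gamma>. payoff S A p r \<beta> \<sigma> s)"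

definition optimal_actions ::
    "'s::topological_space set \<Rightarrow> 'a::topological_space set \<Rightarrow> ('s \<Rightarrow> 'a set) \<Rightarrow> ('s, 'a) kernel \<Rightarrow>
     ('s \<times> 'a \<Rightarrow> real) \<Rightarrow> real \<Rightarrow> 's \<Rightarrow> 'a set" where
  "optimal_actions S A \<Gamma> p r \<beta> s =
     {a. is_arg_max (\<lambda>a. r (s, a) + \<beta> * (LINT s'|p (s, a). value_fun S A \<Gamma> p r \<beta> s'))
           (\<lambda>a. a \<in> \<Gamma> s) a}"

end

theory Submission
  imports Defs
begin

text \<open>
  If \<open>f\<close> is bounded and upper semi-continuous and moves by at most \<open>\<delta>\<close> under the Bellman
  operator, then it is within \<open>\<delta> / (1 - \<beta>)\<close> of the value function: along every strategy the
  discounted expectations of \<open>f\<close> telescope against the payoffs, and a Borel selector of the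
  maximising actions attains the bound. Hence the Bellman iterates of \<open>0\<close> converge to the value
  function, and order properties preserved by the Bellman operator and by pointwise limits pass to it.

  The property propagated compares two parameter values: \<open>f x + g y \<le> f (inf x y) + g (sup x y)\<close>
  for the iterates \<open>f\<close> and \<open>g\<close> of the lower and the higher parameter. It follows from
  supermodularity of \<open>f\<close> and monotonicity of \<open>g - f\<close>, survives maximisation over a supermodular
  correspondence, and for the objective in \<open>(s, a)\<close> it says directly that the argmax ascends.
\<close>

section \<open>Path measures\<close>

text \<open>The parameter set \<open>E\<close> carries only a partial order, so the value function
  is not treated as a supermodular function of state and parameter; two comparable parameter values
  are set against each other instead. On a lattice and for supermodular \<open>f\<close>, the joint
  inequality is equivalent to monotonicity of \<open>g - f\<close>, and the two halves of a Bellman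
  step call for different forms. The kernel hypotheses speak about one integrand at a time, so they
  act on \<open>f\<close> and on \<open>g - f\<close>. Maximisation gives no direct hold on a
  difference of two maxima, whereas in the joint inequality a maximiser at \<open>x\<close> and one
  at \<open>y\<close> combine into feasible actions at \<open>inf x y\<close> and
  \<open>sup x y\<close>. Each step therefore passes from one form to the other and back. With
  unequal discount factors the difference of the objectives contains the further term
  \<open>\<beta>\<^sub>2 - \<beta>\<^sub>1\<close> times the integral of \<open>g\<close>. Its
  monotonicity comes from that of \<open>g\<close>, and this is where the payoff increasing in
  \<open>s\<close> and the growth of \<open>\<Gamma>\<close> enter part (i).\<close>

lemma (in Ionescu_Tulcea) prob_space_lim: "prob_space PF.lim"
proof
  \<comment> \<open>The cylinder over the empty index set is the whole space, and its mass is that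
    of a marginal already known to be a probability measure.\<close>
  have "emeasure PF.lim (PF.emb UNIV {} (space (PiM {} M))) = 1"
    using lim[of "{}" "space (PiM {} M)"] prob_space.emeasure_space_1[OF PF.prob_space_P[of "{}"]]
    by (simp add: PF.space_P)
  then show "emeasure PF.lim (space PF.lim) = 1"
    by (simp add: prod_emb_def space_PiM restrict_def)
qed

text \<open>\<open>CI\<close> composes the kernels up to a bound of the index set and then
  restricts; on an initial segment the restriction changes nothing.\<close>

lemma (in Ionescu_Tulcea) CI_atLeastLessThan: "CI {0..<n} = C 0 n (\<lambda>_. undefined)"
proof -
  have "up_to {0..<n} = n"
    using up_to_iff_Ico[of "{0..<n}" n] up_to[of "{0..<n}"] by (intro antisym) auto
  moreover have "distr (C 0 n (\<lambda>_. undefined)) (PiM {0..<n} M) (\<lambda>f. restrict f {0..<n})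
      = distr (C 0 n (\<lambda>_. undefined)) (C 0 n (\<lambda>_. undefined)) (\<lambda>f. f)"
    by (intro distr_cong) (auto simp: sets_C space_C space_PiM)
  ultimately show ?thesis
    by (simp add: CI_def distr_id)
qed

text \<open>The tower property for coordinate \<open>n\<close>: the marginal on the first
  \<open>n + 1\<close> coordinates is the marginal on the first \<open>n\<close> followed by the
  kernel \<open>P n\<close>. It reduces integrals against the projective limit to the conditional
  laws that generate it.\<close>

lemma (in Ionescu_Tulcea) integral_lim_component:
  fixes f :: "'a \<Rightarrow> real"
  assumes f[measurable]: "f \<in> borel_measurable (M n)"
    and bound: "\<And>x. x \<in> space (M n) \<Longrightarrow> \<bar>f x\<bar> \<le> B"
  shows "(LINT \<omega>|PF.lim. f (\<omega> n)) = (LINT \<omega>|PF.lim. LINT x|P n (restrict \<omega> {0..<n}). f x)"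
proof -
  note [measurable_cong] = PF.sets_lim sets_C
  \<comment> \<open>The composition starts from the empty history, which as an extensional function
    is constantly \<open>undefined\<close>.\<close>
  let ?u = "\<lambda>_::nat. undefined::'a"
  have C_prob: "prob_space (C 0 n ?u)"
    by (rule prob_space_C) simp
  have C_space: "space (C 0 n ?u) = space (PiM {0..<n} M)"
    by (simp add: space_C)
  have restr[measurable]: "(\<lambda>\<omega>. restrict \<omega> {0..<m}) \<in> PF.lim \<rightarrow>\<^sub>M PiM {0..<m} M" for m
    by (subst measurable_cong_sets[OF PF.sets_lim refl]) (intro measurable_restrict_subset; simp)
  have C_distr: "C 0 m ?u = distr PF.lim (PiM {0..<m} M) (\<lambda>\<omega>. restrict \<omega> {0..<m})" for m
    by (simp add: distr_lim CI_atLeastLessThan)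
  have [measurable]: "(\<lambda>\<omega>. f (\<omega> n)) \<in> borel_measurable (PiM {0..<Suc n} M)"
    by measurable
  have "(LINT \<omega>|PF.lim. f (\<omega> n)) = (LINT \<omega>|C 0 (Suc n) ?u. f (\<omega> n))"
    unfolding C_distr by (subst integral_distr) auto
  also have "\<dots> = (LINT h|C 0 n ?u. LINT \<omega>|eP n h. f (\<omega> n))"
    unfolding C.simps add_0
  proof (rule integral_bind[where B = B and B' = 1])
    show "eP n \<in> C 0 n ?u \<rightarrow>\<^sub>M subprob_algebra (PiM {0..<Suc n} M)"
      using measurable_eP by (simp cong: measurable_cong_sets add: sets_C)
    show "finite_measure (C 0 n ?u)"
      using C_prob by (simp add: prob_space_def)
    show "AE h in C 0 n ?u. emeasure (eP n h) (space (eP n h)) \<le> ennreal 1"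
      using prob_space_eP by (intro AE_I2) (simp add: C_space prob_space.emeasure_space_1)
    show "\<bar>f (\<omega> n)\<bar> \<le> B" if "\<omega> \<in> space (PiM {0..<Suc n} M)" for \<omega>
      using that by (intro bound) (auto simp: space_PiM PiE_iff)
  qed measurable
  \<comment> \<open>\<open>eP n h\<close> extends \<open>h\<close> at index \<open>n\<close> by a
    draw from \<open>P n h\<close>, and reading off that index returns the draw.\<close>
  also have "\<dots> = (LINT h|C 0 n ?u. LINT x|P n h. f x)"
  proof (rule Bochner_Integration.integral_cong[OF refl])
    fix h assume "h \<in> space (C 0 n ?u)"
    then have h: "h \<in> space (PiM {0..<n} M)"
      by (simp add: C_space)
    have "fun_upd h n \<in> P n h \<rightarrow>\<^sub>M PiM {0..<Suc n} M"
      using h by (intro measurable_fun_upd[where J="{0..<n}"]) (auto simp: sets_P[OF h] cong: measurable_cong_sets)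
    then show "(LINT \<omega>|eP n h. f (\<omega> n)) = (LINT x|P n h. f x)"
      unfolding eP_def by (subst integral_distr) auto
  qed
  also have "\<dots> = (LINT \<omega>|PF.lim. LINT x|P n (restrict \<omega> {0..<n}). f x)"
  proof -
    have "(\<lambda>h. LINT x|P n h. f x) \<in> borel_measurable (PiM {0..<n} M)"
      by measurable
    then show ?thesis
      unfolding C_distr by (subst integral_distr) auto
  qed
  finally show ?thesis .
qed

lemma (in prob_space) abs_expectation_le:
  fixes X :: "'a \<Rightarrow> real"
  assumes X: "X \<in> borel_measurable M" and B: "\<And>x. x \<in> space M \<Longrightarrow> \<bar>X x\<bar> \<le> B"
  shows "integrable M X" "\<bar>expectation X\<bar> \<le> B"
proof -
  show int: "integrable M X"
    using X B by (intro integrable_const_bound[where B = B] AE_I2) auto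
  have "X x \<le> B" "- B \<le> X x" if "x \<in> space M" for x
    using B[OF that] by (auto simp: abs_le_iff)
  then have "expectation X \<le> B" "- B \<le> expectation X"
    using int by (auto intro!: integral_le_const integral_ge_const AE_I2)
  then show "\<bar>expectation X\<bar> \<le> B"
    by (simp add: abs_le_iff)
qed

text \<open>This direction rests on second countability, which puts every Borel set of the product
  into the product sigma-algebra.\<close>

lemma measurable_pair_borel_on:
  fixes S :: "'a::second_countable_topology set" and A :: "'b::second_countable_topology set"
  shows "(\<lambda>x. x) \<in> borel_on S \<Otimes>\<^sub>M borel_on A \<rightarrow>\<^sub>M borel_on (S \<times> A)"
proof (rule measurable_restrict_space2)
  show "(\<lambda>x. x) \<in> space (borel_on S \<Otimes>\<^sub>M borel_on A) \<rightarrow> S \<times> A"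
    by (auto simp: space_pair_measure space_restrict_space)
  have "(\<lambda>x. (fst x, snd x)) \<in> borel_measurable (borel_on S \<Otimes>\<^sub>M borel_on A)"
    by (intro borel_measurable_Pair measurable_compose[OF measurable_fst] measurable_compose[OF measurable_snd]
        measurable_restrict_space1) auto
  then show "(\<lambda>x. x) \<in> borel_measurable (borel_on S \<Otimes>\<^sub>M borel_on A)"
    by simp
qed

lemma measurable_fst_borel_on:
  fixes S :: "'a::second_countable_topology set" and A :: "'b::second_countable_topology set"
  shows "fst \<in> borel_on (S \<times> A) \<rightarrow>\<^sub>M borel_on S"
  by (intro measurable_restrict_space2 measurable_restrict_space1)
     (auto simp: space_restrict_space intro!: borel_measurable_continuous_onI continuous_intros)

section \<open>Conditional laws of states and of state-action pairs along a strategy\<close>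

context dynamic_program
begin

text \<open>The state part of \<open>step_law\<close>. Given the past, the action is a function of
  the new state, so the law of the pair is a push-forward of this measure and integrals over pairs
  become integrals over states.\<close>

definition state_law :: "real ^ 'n \<Rightarrow> nat \<Rightarrow> (nat \<Rightarrow> (real ^ 'n) \<times> (real ^ 'k)) \<Rightarrow> (real ^ 'n) measure" where
  "state_law s t h = (case t of 0 \<Rightarrow> return (borel_on S) s | Suc u \<Rightarrow> p (h u))"

lemma state_law_measurable:
  assumes "s \<in> S"
  shows "state_law s t \<in> PiM {0..<t} (\<lambda>_. borel_on (S \<times> A)) \<rightarrow>\<^sub>M prob_algebra (borel_on S)"
proof (cases t)
  case 0
  then show ?thesis
    using assms
    by (auto simp: state_law_def[abs_def] space_prob_algebra space_restrict_space intro!: prob_space_return)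
next
  case (Suc u)
  then show ?thesis
    by (auto simp: state_law_def[abs_def] intro!: measurable_compose[OF _ kernel] measurable_component_singleton)
qed

lemma state_law_at:
  assumes "s \<in> S" "h \<in> space (PiM {0..<t} (\<lambda>_. borel_on (S \<times> A)))"
  shows "prob_space (state_law s t h)" "sets (state_law s t h) = sets (borel_on S)" "space (state_law s t h) = S"
proof -
  have "state_law s t h \<in> space (prob_algebra (borel_on S))"
    using measurable_space[OF state_law_measurable] assms by blast
  then show "prob_space (state_law s t h)" and *: "sets (state_law s t h) = sets (borel_on S)"
    by (auto simp: space_prob_algebra)
  from sets_eq_imp_space_eq[OF *] show "space (state_law s t h) = S"
    by (simp add: space_restrict_space)
qed

lemma strategy_pair_measurable:
  assumes "\<sigma> \<in> strategies S A \<Gamma>"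
  shows "(\<lambda>(h, s'). (s', \<sigma> t h s'))
    \<in> PiM {0..<t} (\<lambda>_. borel_on (S \<times> A)) \<Otimes>\<^sub>M borel_on S \<rightarrow>\<^sub>M borel_on (S \<times> A)" (is "_ \<in> ?N \<rightarrow>\<^sub>M _")
proof -
  have "(\<lambda>(h, s'). \<sigma> t h s') \<in> ?N \<rightarrow>\<^sub>M borel_on A"
    using assms by (simp add: strategies_def)
  then have "(\<lambda>x. (snd x, (\<lambda>(h, s'). \<sigma> t h s') x)) \<in> ?N \<rightarrow>\<^sub>M borel_on S \<Otimes>\<^sub>M borel_on A"
    by (intro measurable_Pair measurable_snd)
  from measurable_compose[OF this measurable_pair_borel_on] show ?thesis
    by (simp add: split_beta)
qed

lemma strategy_section_measurable:
  assumes "\<sigma> \<in> strategies S A \<Gamma>" "h \<in> space (PiM {0..<t} (\<lambda>_. borel_on (S \<times> A)))"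
  shows "(\<lambda>s'. (s', \<sigma> t h s')) \<in> borel_on S \<rightarrow>\<^sub>M borel_on (S \<times> A)"
  using measurable_compose[OF measurable_Pair1'[OF assms(2)] strategy_pair_measurable[OF assms(1)]] by simp

lemma step_law_eq:
  "step_law S A p \<sigma> s t h = distr (state_law s t h) (borel_on (S \<times> A)) (\<lambda>s'. (s', \<sigma> t h s'))"
  by (simp add: step_law_def state_law_def)

lemma Ionescu_Tulcea_step_law:
  assumes \<sigma>: "\<sigma> \<in> strategies S A \<Gamma>" and s: "s \<in> S"
  shows "Ionescu_Tulcea (step_law S A p \<sigma> s) (\<lambda>_. borel_on (S \<times> A))"
proof (rule Ionescu_Tulcea.intro)
  fix t :: nat
  let ?H = "PiM {0..<t} (\<lambda>_. borel_on (S \<times> A))"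
  show "step_law S A p \<sigma> s t \<in> ?H \<rightarrow>\<^sub>M subprob_algebra (borel_on (S \<times> A))"
    unfolding step_law_eq[abs_def]
    using measurable_distr2[OF strategy_pair_measurable[OF \<sigma>] measurable_prob_algebraD[OF state_law_measurable[OF s]]]
    by simp
  fix h assume h: "h \<in> space ?H"
  show "prob_space (step_law S A p \<sigma> s t h)"
    unfolding step_law_eq using state_law_at[OF s h] strategy_section_measurable[OF \<sigma> h]
    by (auto intro!: prob_space.prob_space_distr cong: measurable_cong_sets)
qed

lemma integral_step_law:
  fixes g :: "(real ^ 'n) \<times> (real ^ 'k) \<Rightarrow> real"
  assumes "\<sigma> \<in> strategies S A \<Gamma>" "s \<in> S" "h \<in> space (PiM {0..<t} (\<lambda>_. borel_on (S \<times> A)))"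
    and "g \<in> borel_measurable (borel_on (S \<times> A))"
  shows "(LINT x|step_law S A p \<sigma> s t h. g x) = (LINT s'|state_law s t h. g (s', \<sigma> t h s'))"
  unfolding step_law_eq using strategy_section_measurable[OF assms(1,3)] assms(4) state_law_at(2)[OF assms(2,3)]
  by (intro integral_distr) (auto cong: measurable_cong_sets)

end

section \<open>Upper semi-continuity and measurable selection\<close>

lemma usc_on_subset:
  assumes "usc_on Y f" "X \<subseteq> Y"
  shows "usc_on X f"
  unfolding usc_on_def
proof
  fix t
  obtain U where "open U" "{x\<in>Y. f x < t} = Y \<inter> U"
    using assms(1) unfolding usc_on_def openin_open by blast
  moreover from this have "{x\<in>X. f x < t} = X \<inter> U"
    using assms(2) by blast
  ultimately show "openin (top_of_set X) {x\<in>X. f x < t}"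
    by (simp add: openin_open_Int)
qed

lemma usc_on_section:
  assumes f: "usc_on (X \<times> Y) f" and x: "x \<in> X"
  shows "usc_on Y (\<lambda>y. f (x, y))"
  unfolding usc_on_def
proof
  fix t
  obtain U where U: "open U" "{z\<in>X \<times> Y. f z < t} = (X \<times> Y) \<inter> U"
    using f unfolding usc_on_def openin_open by blast
  have "{y\<in>Y. f (x, y) < t} = Y \<inter> (Pair x -` U)"
    using U(2) x by blast
  moreover have "open (Pair x -` U)"
    using U(1) by (intro open_vimage continuous_intros)
  ultimately show "openin (top_of_set Y) {y\<in>Y. f (x, y) < t}"
    by (simp add: openin_open_Int)
qed

lemma usc_on_borel_measurable:
  assumes "usc_on X f"
  shows "f \<in> borel_measurable (borel_on X)"
  unfolding borel_measurable_iff_less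
proof
  fix t
  obtain U where "open U" "{x\<in>X. f x < t} = X \<inter> U"
    using assms unfolding usc_on_def openin_open by blast
  then show "{x \<in> space (borel_on X). f x < t} \<in> sets (borel_on X)"
    by (auto simp: space_restrict_space sets_restrict_space)
qed

lemma usc_on_const: "usc_on X (\<lambda>_. c)"
proof -
  have "{x\<in>X. c < t} = (if c < t then X else {})" for t
    by auto
  then show ?thesis
    by (simp add: usc_on_def)
qed

lemma usc_on_add:
  assumes "usc_on X f" "usc_on X g"
  shows "usc_on X (\<lambda>x. f x + g x)"
  unfolding usc_on_def
proof
  fix t
  have "{x\<in>X. f x + g x < t} = (\<Union>q. {x\<in>X. f x < q} \<inter> {x\<in>X. g x < t - q})"
  proof (intro set_eqI iffI)
    fix x assume "x \<in> {x\<in>X. f x + g x < t}"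
    then have "x \<in> X" "f x < t - g x"
      by auto
    then obtain q where "f x < q" "q < t - g x"
      using dense by blast
    then show "x \<in> (\<Union>q. {x\<in>X. f x < q} \<inter> {x\<in>X. g x < t - q})"
      using \<open>x \<in> X\<close> by auto
  qed auto
  moreover have "openin (top_of_set X) ({x\<in>X. f x < q} \<inter> {x\<in>X. g x < t - q})" for q
    using assms unfolding usc_on_def by (intro openin_Int) auto
  ultimately show "openin (top_of_set X) {x\<in>X. f x + g x < t}"
    by auto
qed

lemma usc_on_cmult:
  assumes "usc_on X f" "0 < c"
  shows "usc_on X (\<lambda>x. c * f x)"
proof -
  have "{x\<in>X. c * f x < t} = {x\<in>X. f x < t / c}" for t
    using assms(2) by (auto simp: field_simps)
  then show ?thesis
    using assms(1) by (simp add: usc_on_def)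
qed

lemma continuous_on_imp_usc_on:
  assumes "continuous_on X f"
  shows "usc_on X f"
proof -
  have "{x\<in>X. f x < t} = X \<inter> f -` {..<t}" for t
    by blast
  then show ?thesis
    using continuous_openin_preimage_gen[OF assms open_lessThan] by (simp add: usc_on_def)
qed

lemma usc_on_superlevel_closedin:
  assumes "usc_on X f"
  shows "closedin (top_of_set X) {x\<in>X. t \<le> f x}"
proof -
  have "X - {x\<in>X. t \<le> f x} = {x\<in>X. f x < t}"
    by auto
  then show ?thesis
    using assms by (simp add: closedin_def usc_on_def)
qed

text \<open>If no maximum were attained, the sets on which \<open>f\<close> lies strictly below
  \<open>f y\<close>, for \<open>y\<close> in \<open>K\<close>, would form an open cover. In a
  finite subcover the centre with the largest value would be left uncovered.\<close>

lemma usc_on_attains_max: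
  assumes "compact K" "K \<noteq> {}" "usc_on K f"
  obtains x where "x \<in> K" "\<And>y. y \<in> K \<Longrightarrow> f y \<le> f x"
proof (rule ccontr)
  assume "\<not> thesis"
  then have above: "\<forall>x\<in>K. \<exists>y\<in>K. f x < f y"
    using that by (metis not_le)
  have "\<exists>U. open U \<and> {x\<in>K. f x < f y} = K \<inter> U" for y
    using assms(3) unfolding usc_on_def openin_open by blast
  then obtain U where U: "\<And>y. open (U y)" "\<And>y. {x\<in>K. f x < f y} = K \<inter> U y"
    by metis
  have "K \<subseteq> (\<Union>y\<in>K. U y)"
    using above U(2) by blast
  then obtain C where C: "C \<subseteq> K" "finite C" "K \<subseteq> (\<Union>y\<in>C. U y)"
    using compactE_image[OF assms(1), of K U] U(1) by metis
  have "C \<noteq> {}"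
    using C assms(2) by auto
  with C(2) have "Max (f ` C) \<in> f ` C"
    by simp
  then obtain x where x: "x \<in> C" "f x = Max (f ` C)"
    by (metis imageE)
  then obtain y where "y \<in> C" "x \<in> U y"
    using C by blast
  then have "f x < f y"
    using U(2)[of y] x(1) C(1) by blast
  moreover have "f y \<le> f x"
    using x(2) C(2) \<open>y \<in> C\<close> by simp
  ultimately show False
    by simp
qed

text \<open>Measurability of a correspondence, tested on closed sets. For one-point values it is
  ordinary Borel measurability. Closed tests suit compact values: \<open>F s \<inter> C\<close> is
  again compact, so upper semi-continuous functions attain a maximum on it when it is
  nonempty.\<close>

definition hit_measurable :: "'s measure \<Rightarrow> ('s \<Rightarrow> 'a::topological_space set) \<Rightarrow> bool" where
  "hit_measurable M F \<longleftrightarrow> (\<forall>C. closed C \<longrightarrow> {s\<in>space M. F s \<inter> C \<noteq> {}} \<in> sets M)"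

text \<open>The argmax meets \<open>C\<close> exactly when the maximum over
  \<open>F s \<inter> C\<close> equals the maximum over \<open>F s\<close>. Comparing the two at
  rational thresholds expresses this by countably many sets of the form assumed measurable.\<close>

lemma argmax_hit_measurable:
  fixes F :: "'s \<Rightarrow> 'a::t2_space set" and w :: "'s \<Rightarrow> 'a \<Rightarrow> real"
  assumes F: "\<And>s. s \<in> space M \<Longrightarrow> compact (F s)" "\<And>s. s \<in> space M \<Longrightarrow> F s \<noteq> {}"
    and usc: "\<And>s. s \<in> space M \<Longrightarrow> usc_on (F s) (w s)"
    and meas: "\<And>C t. closed C \<Longrightarrow> {s\<in>space M. \<exists>a\<in>F s \<inter> C. t \<le> w s a} \<in> sets M"
    and G_def: "\<And>s. G s = {a\<in>F s. \<forall>b\<in>F s. w s b \<le> w s a}"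
  shows "\<And>s. s \<in> space M \<Longrightarrow> compact (G s)" "\<And>s. s \<in> space M \<Longrightarrow> G s \<noteq> {}"
    and "hit_measurable M G"
proof -
  fix s assume s: "s \<in> space M"
  obtain a where a: "a \<in> F s" "\<And>b. b \<in> F s \<Longrightarrow> w s b \<le> w s a"
    using usc_on_attains_max[OF F(1) F(2) usc] s by metis
  then show "G s \<noteq> {}"
    by (auto simp: G_def)
  have "G s = {b\<in>F s. w s a \<le> w s b}"
    using a by (auto simp: G_def intro: order_trans)
  with usc_on_superlevel_closedin[OF usc[OF s], of "w s a"] show "compact (G s)"
    using closedin_compact[OF F(1)[OF s]] by simp
next
  show "hit_measurable M G"
    unfolding hit_measurable_def
  proof (intro allI impI)
    fix C :: "'a set" assume C: "closed C"
    let ?L = "\<lambda>C t s. \<exists>a\<in>F s \<inter> C. t \<le> w s a"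
    \<comment> \<open>The first conjunct says through threshold sets that \<open>F s\<close> meets
      \<open>C\<close>; the second, that every rational level reached on \<open>F s\<close> is also
      reached inside \<open>C\<close>.\<close>
    have eq: "G s \<inter> C \<noteq> {} \<longleftrightarrow>
        (\<exists>n::nat. ?L C (- real n) s) \<and> (\<forall>q::rat. ?L UNIV (of_rat q) s \<longrightarrow> ?L C (of_rat q) s)"
      if s: "s \<in> space M" for s
    proof
      assume "G s \<inter> C \<noteq> {}"
      then obtain a where a: "a \<in> F s" "a \<in> C" "\<And>b. b \<in> F s \<Longrightarrow> w s b \<le> w s a"
        by (auto simp: G_def)
      obtain n :: nat where "- w s a \<le> real n"
        using real_arch_simple by blast
      then have "- real n \<le> w s a"
        by simp
      with a show "(\<exists>n::nat. ?L C (- real n) s) \<and> (\<forall>q::rat. ?L UNIV (of_rat q) s \<longrightarrow> ?L C (of_rat q) s)"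
        by (auto intro: order_trans)
    next
      assume R: "(\<exists>n::nat. ?L C (- real n) s) \<and> (\<forall>q::rat. ?L UNIV (of_rat q) s \<longrightarrow> ?L C (of_rat q) s)"
      then have ne: "F s \<inter> C \<noteq> {}"
        by auto
      have "compact (F s \<inter> C)" "usc_on (F s \<inter> C) (w s)"
        using F(1)[OF s] C usc[OF s] by (auto intro: compact_Int_closed usc_on_subset)
      then obtain c where c: "c \<in> F s \<inter> C" "\<And>b. b \<in> F s \<inter> C \<Longrightarrow> w s b \<le> w s c"
        using usc_on_attains_max ne by metis
      have "w s b \<le> w s c" if b: "b \<in> F s" for b
      proof (rule ccontr)
        assume "\<not> w s b \<le> w s c"
        then obtain q where q: "w s c < of_rat q" "of_rat q < w s b"
          using of_rat_dense[of "w s c" "w s b"] by auto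
        then have "?L C (of_rat q) s"
          using R b less_imp_le by blast
        with c(2) q(1) show False
          by force
      qed
      with c(1) show "G s \<inter> C \<noteq> {}"
        by (auto simp: G_def)
    qed
    have "{s\<in>space M. (\<exists>n::nat. ?L C (- real n) s) \<and> (\<forall>q::rat. ?L UNIV (of_rat q) s \<longrightarrow> ?L C (of_rat q) s)} \<in> sets M"
      by (intro sets.sets_Collect sets.sets_Collect_countable_All sets.sets_Collect_countable_Ex meas C closed_UNIV)
    moreover have "{s\<in>space M. G s \<inter> C \<noteq> {}} = {s\<in>space M. (\<exists>n::nat. ?L C (- real n) s) \<and> (\<forall>q::rat. ?L UNIV (of_rat q) s \<longrightarrow> ?L C (of_rat q) s)}"
      using eq by blast
    ultimately show "{s\<in>space M. G s \<inter> C \<noteq> {}} \<in> sets M"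
      by simp
  qed
qed

text \<open>Successively minimising every coordinate shrinks the values to single points.\<close>

lemma measurable_selection:
  fixes F :: "'s \<Rightarrow> 'a::euclidean_space set"
  assumes F: "\<And>s. s \<in> space M \<Longrightarrow> compact (F s)" "\<And>s. s \<in> space M \<Longrightarrow> F s \<noteq> {}"
    and hit: "hit_measurable M F"
  obtains \<phi> where "\<phi> \<in> borel_measurable M" "\<And>s. s \<in> space M \<Longrightarrow> \<phi> s \<in> F s"
proof -
  define refines where "refines B G \<longleftrightarrow>
      (\<forall>s\<in>space M. compact (G s) \<and> G s \<noteq> {} \<and> G s \<subseteq> F s \<and>
        (\<forall>x\<in>G s. \<forall>y\<in>G s. \<forall>b\<in>B. x \<bullet> b = y \<bullet> b)) \<and> hit_measurable M G"
    for B and G :: "'s \<Rightarrow> 'a set"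
  have "\<exists>G. refines B G" if "finite B" for B
    using that
  proof induction
    case empty
    then show ?case
      using F hit by (intro exI[of _ F]) (auto simp: refines_def)
  next
    case (insert b B)
    then obtain G where ref: "refines B G"
      by blast
    then have G: "\<And>s. s \<in> space M \<Longrightarrow> compact (G s)" "\<And>s. s \<in> space M \<Longrightarrow> G s \<noteq> {}"
        "\<And>s. s \<in> space M \<Longrightarrow> G s \<subseteq> F s"
      and hit_G: "hit_measurable M G"
      by (auto simp: refines_def)
    \<comment> \<open>Minimising the coordinate is written as maximising its negative, so that the
      argmax lemma applies; all points of \<open>H s\<close> then agree at \<open>b\<close>.\<close>
    define H where "H s = {x\<in>G s. \<forall>y\<in>G s. - (y \<bullet> b) \<le> - (x \<bullet> b)}" for s
    have usc: "usc_on (G s) (\<lambda>x. - (x \<bullet> b))" for s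
      by (intro continuous_on_imp_usc_on continuous_intros)
    have meas: "{s\<in>space M. \<exists>x\<in>G s \<inter> C. t \<le> - (x \<bullet> b)} \<in> sets M" if C: "closed C" for C t
    proof -
      \<comment> \<open>The threshold is a closed condition on \<open>x\<close> that does not
        involve \<open>s\<close>, so it can be absorbed into the test set.\<close>
      have "closed (C \<inter> {x. t \<le> - (x \<bullet> b)})"
        using C by (intro closed_Int closed_Collect_le continuous_intros)
      then have "{s\<in>space M. G s \<inter> (C \<inter> {x. t \<le> - (x \<bullet> b)}) \<noteq> {}} \<in> sets M"
        using hit_G by (simp add: hit_measurable_def)
      moreover have "{s\<in>space M. G s \<inter> (C \<inter> {x. t \<le> - (x \<bullet> b)}) \<noteq> {}}
          = {s\<in>space M. \<exists>x\<in>G s \<inter> C. t \<le> - (x \<bullet> b)}"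
        by blast
      ultimately show ?thesis
        by simp
    qed
    note H = argmax_hit_measurable[where F = G and w = "\<lambda>_ x. - (x \<bullet> b)", OF G(1,2) usc meas H_def]
    have eq: "x \<bullet> c = y \<bullet> c"
      if "s \<in> space M" "x \<in> H s" "y \<in> H s" "c \<in> insert b B" for s x y c
    proof (cases "c = b")
      case True
      with that show ?thesis
        by (auto simp: H_def intro: order_antisym)
    next
      case False
      with that ref show ?thesis
        unfolding refines_def H_def by blast
    qed
    have sub: "H s \<subseteq> F s" if "s \<in> space M" for s
      using G(3)[OF that] by (auto simp: H_def)
    have "refines (insert b B) H"
      unfolding refines_def
      by (intro conjI ballI H sub eq)
    then show ?case
      by blast
  qed
  from this[OF finite_Basis] obtain G where ref: "refines Basis G"
    by blast
  then have G: "\<And>s. s \<in> space M \<Longrightarrow> G s \<noteq> {}" "\<And>s. s \<in> space M \<Longrightarrow> G s \<subseteq> F s"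
    and hit_G: "hit_measurable M G"
    by (auto simp: refines_def)
  have unique: "x = y" if "s \<in> space M" "x \<in> G s" "y \<in> G s" for s x y
  proof (rule euclidean_eqI)
    show "x \<bullet> b = y \<bullet> b" if "b \<in> Basis" for b
      using ref \<open>s \<in> space M\<close> \<open>x \<in> G s\<close> \<open>y \<in> G s\<close> that unfolding refines_def by blast
  qed
  define \<phi> where "\<phi> = (\<lambda>s. SOME a. a \<in> G s)"
  have \<phi>: "\<phi> s \<in> G s" if "s \<in> space M" for s
    unfolding \<phi>_def using G(1)[OF that] by (simp add: some_in_eq)
  then have G_single: "G s = {\<phi> s}" if "s \<in> space M" for s
    using unique[OF that] that by blast
  have "\<phi> \<in> borel_measurable M"
  proof (rule borel_measurableI)
    fix U :: "'a set" assume "open U"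
    \<comment> \<open>As \<open>G s\<close> is the single point \<open>\<phi> s\<close>, it avoids
      the closed set \<open>- U\<close> exactly when \<open>\<phi> s\<close> lies in
      \<open>U\<close>.\<close>
    then have "space M - {s\<in>space M. G s \<inter> - U \<noteq> {}} \<in> sets M"
      using hit_G by (intro sets.compl_sets) (simp add: hit_measurable_def closed_Compl)
    moreover have "\<phi> -` U \<inter> space M = space M - {s\<in>space M. G s \<inter> - U \<noteq> {}}"
      by (auto simp: G_single)
    ultimately show "\<phi> -` U \<inter> space M \<in> sets M"
      by simp
  qed
  then show thesis
  proof (rule that)
    show "\<phi> s \<in> F s" if "s \<in> space M" for s
      using \<phi>[OF that] G(2)[OF that] by blast
  qed
qed

text \<open>Weighted by \<open>\<beta> ^ t\<close>, the one-step inequalities telescope. The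
  remainder \<open>\<beta> ^ t * y t\<close> vanishes because \<open>y\<close> is bounded, and the
  errors add up to \<open>\<delta>\<close> times a geometric series, whence
  \<open>\<delta> / (1 - \<beta>)\<close>.\<close>

lemma discounted_sum_le:
  fixes x y :: "nat \<Rightarrow> real"
  assumes \<beta>: "0 < \<beta>" "\<beta> < 1"
    and x: "summable (\<lambda>t. \<beta> ^ t * x t)"
    and y: "\<And>t. \<bar>y t\<bar> \<le> B"
    and step: "\<And>t. x t + \<beta> * y (Suc t) \<le> y t + \<delta>"
  shows "(\<Sum>t. \<beta> ^ t * x t) \<le> y 0 + \<delta> / (1 - \<beta>)"
proof -
  have "(\<lambda>t. \<beta> ^ t * B) \<longlonglongrightarrow> 0 * B"
    using \<beta> by (intro tendsto_mult tendsto_const LIMSEQ_realpow_zero) auto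
  then have "(\<lambda>t. \<beta> ^ t * B) \<longlonglongrightarrow> 0"
    by simp
  moreover have "norm (\<beta> ^ t * y t) \<le> \<beta> ^ t * B" for t
    using y[of t] \<beta> by (simp add: abs_mult mult_left_mono)
  ultimately have "(\<lambda>t. \<beta> ^ t * y t) \<longlonglongrightarrow> 0"
    by (rule Lim_null_comparison[OF always_eventually[OF allI], rotated])
  then have tele: "(\<lambda>t. \<beta> ^ t * y t - \<beta> ^ Suc t * y (Suc t)) sums (\<beta> ^ 0 * y 0 - 0)"
    by (rule telescope_sums')
  have "(\<lambda>t. \<delta> * \<beta> ^ t) sums (\<delta> * (1 / (1 - \<beta>)))"
    using \<beta> by (intro sums_mult geometric_sums) auto
  from sums_add[OF tele this]
  have "(\<lambda>t. \<beta> ^ t * y t - \<beta> ^ Suc t * y (Suc t) + \<delta> * \<beta> ^ t) sums (y 0 + \<delta> / (1 - \<beta>))"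
    by simp
  from _ summable_sums[OF x] this show ?thesis
  proof (rule sums_le)
    show "\<beta> ^ t * x t \<le> \<beta> ^ t * y t - \<beta> ^ Suc t * y (Suc t) + \<delta> * \<beta> ^ t" for t
    using mult_left_mono[OF step[of t], of "\<beta> ^ t"] \<beta> by (simp add: algebra_simps)
  qed
qed

section \<open>The Bellman operator\<close>

locale discounted_program = dynamic_program S A \<Gamma> p r
  for S :: "(real ^ 'n) set" and A :: "(real ^ 'k) set" and \<Gamma> p r +
  fixes \<beta> :: real
  assumes discount: "0 < \<beta>" "\<beta> < 1"
begin

text \<open>The class of integrands that \<open>kernel_usc\<close> controls; \<open>bellman\<close>
  maps it into itself.\<close>

definition admissible :: "(real ^ 'n \<Rightarrow> real) \<Rightarrow> bool" where
  "admissible f \<longleftrightarrow> usc_on S f \<and> bounded (f ` S)"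

definition action_value :: "(real ^ 'n \<Rightarrow> real) \<Rightarrow> (real ^ 'n) \<times> (real ^ 'k) \<Rightarrow> real" where
  "action_value f x = r x + \<beta> * (LINT s'|p x. f s')"

definition bellman :: "(real ^ 'n \<Rightarrow> real) \<Rightarrow> real ^ 'n \<Rightarrow> real" where
  "bellman f s = (SUP a\<in>\<Gamma> s. action_value f (s, a))"

abbreviation "optimal_value \<equiv> value_fun S A \<Gamma> p r \<beta>"

lemma kernel_at:
  assumes "x \<in> S \<times> A"
  shows "prob_space (p x)" "sets (p x) = sets (borel_on S)" "space (p x) = S"
proof -
  have "p x \<in> space (prob_algebra (borel_on S))"
    using measurable_space[OF kernel, of x] assms by (simp add: space_restrict_space)
  then show "prob_space (p x)" "sets (p x) = sets (borel_on S)"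
    by (auto simp: space_prob_algebra)
  then show "space (p x) = S"
    using sets_eq_imp_space_eq[of "p x" "borel_on S"] by (simp add: space_restrict_space)
qed

lemma
  fixes f :: "real ^ 'n \<Rightarrow> real"
  assumes "x \<in> S \<times> A" "f \<in> borel_measurable (borel_on S)" "\<And>s. s \<in> S \<Longrightarrow> \<bar>f s\<bar> \<le> B"
  shows kernel_integrable: "integrable (p x) f"
    and kernel_integral_abs_le: "\<bar>LINT s|p x. f s\<bar> \<le> B"
proof -
  interpret prob_space "p x"
    using assms(1) by (rule kernel_at)
  have "f \<in> borel_measurable (p x)"
    using assms(2) kernel_at(2)[OF assms(1)] by (simp cong: measurable_cong_sets)
  from abs_expectation_le[OF this] show "integrable (p x) f" "\<bar>LINT s|p x. f s\<bar> \<le> B"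
    using assms(3) kernel_at(3)[OF assms(1)] by auto
qed

lemma payoff_bound: obtains R where "0 \<le> R" "\<And>x. x \<in> S \<times> A \<Longrightarrow> \<bar>r x\<bar> \<le> R"
  using payoff_bounded unfolding bounded_iff
  by (metis abs_ge_zero abs_le_D1 imageI linorder_not_le order_le_less_trans order_less_imp_le real_norm_def)

lemma admissible_measurable: "admissible f \<Longrightarrow> f \<in> borel_measurable (borel_on S)"
  by (simp add: admissible_def usc_on_borel_measurable)

lemma admissible_bound:
  assumes "admissible f"
  obtains B where "\<And>s. s \<in> S \<Longrightarrow> \<bar>f s\<bar> \<le> B"
  using assms unfolding admissible_def bounded_iff by auto

lemma admissible_zero: "admissible (\<lambda>_. 0)"
  by (auto simp: admissible_def usc_on_const bounded_iff)

lemma action_value_usc: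
  assumes "admissible f"
  shows "usc_on (S \<times> A) (action_value f)"
proof -
  have "usc_on (S \<times> A) (\<lambda>x. LINT s'|p x. f s')"
    using assms kernel_usc by (simp add: admissible_def usc_kernel_def)
  then show ?thesis
    unfolding action_value_def[abs_def] using payoff_usc discount(1)
    by (intro usc_on_add usc_on_cmult)
qed

lemma action_value_bound:
  assumes f: "f \<in> borel_measurable (borel_on S)" "\<And>s. s \<in> S \<Longrightarrow> \<bar>f s\<bar> \<le> B"
  obtains C where "\<And>x. x \<in> S \<times> A \<Longrightarrow> \<bar>action_value f x\<bar> \<le> C"
proof -
  obtain R where R: "\<And>x. x \<in> S \<times> A \<Longrightarrow> \<bar>r x\<bar> \<le> R"
    using payoff_bound by metis
  have "\<bar>action_value f x\<bar> \<le> R + \<beta> * B" if "x \<in> S \<times> A" for x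
  proof -
    have "\<bar>\<beta> * (LINT s'|p x. f s')\<bar> \<le> \<beta> * B"
      using kernel_integral_abs_le[OF that f] discount(1) by (simp add: abs_mult)
    then show ?thesis
      using R[OF that] unfolding action_value_def by linarith
  qed
  then show thesis
    by (rule that)
qed

lemma bellman_attained:
  assumes f: "admissible f" and s: "s \<in> S"
  obtains a where "a \<in> \<Gamma> s" "bellman f s = action_value f (s, a)"
    "\<And>b. b \<in> \<Gamma> s \<Longrightarrow> action_value f (s, b) \<le> bellman f s"
proof -
  have "usc_on (\<Gamma> s) (\<lambda>a. action_value f (s, a))"
    using usc_on_section[OF action_value_usc[OF f] s] feasible_subset[OF s] by (rule usc_on_subset)
  then obtain a where a: "a \<in> \<Gamma> s" "\<And>b. b \<in> \<Gamma> s \<Longrightarrow> action_value f (s, b) \<le> action_value f (s, a)"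
    using usc_on_attains_max[OF feasible_compact[OF s] feasible_nonempty[OF s]] by metis
  then have "bellman f s = action_value f (s, a)"
    unfolding bellman_def by (intro cSup_eq_maximum) auto
  with a that show thesis
    by metis
qed

text \<open>A tube argument: compactness of \<open>\<Gamma> s\<close> yields an open rectangle
  around \<open>{s} \<times> \<Gamma> s\<close> inside \<open>W\<close>, and upper semi-continuity
  keeps nearby feasible sets in its action side. It serves both the semi-continuity of the maximum
  and the measurability of the maximisers.\<close>

lemma feasible_graph_open:
  assumes W: "openin (top_of_set (S \<times> A)) W"
  shows "openin (top_of_set S) {s\<in>S. \<forall>a\<in>\<Gamma> s. (s, a) \<in> W}"
proof (subst openin_subopen, intro ballI)
  fix s assume "s \<in> {s\<in>S. \<forall>a\<in>\<Gamma> s. (s, a) \<in> W}"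
  then have s: "s \<in> S" and sub: "{s} \<times> \<Gamma> s \<subseteq> W"
    by auto
  have W': "openin (prod_topology (top_of_set S) (top_of_set A)) W"
    using W by (simp add: subtopology_Times[symmetric])
  have comp: "compactin (top_of_set S) {s}" "compactin (top_of_set A) (\<Gamma> s)"
    using s feasible_compact feasible_subset by (auto simp: compactin_subtopology)
  obtain U V where U: "openin (top_of_set S) U" "{s} \<subseteq> U"
    and V: "openin (top_of_set A) V" "\<Gamma> s \<subseteq> V" and UV: "U \<times> V \<subseteq> W"
    by (rule Wallace_theorem_prod_topology[OF comp W' sub])
  have "openin (top_of_set S) (U \<inter> {s\<in>S. \<Gamma> s \<subseteq> V})"
    using U(1) V(1) feasible_usc by (auto simp: usc_corr_def)
  moreover have "U \<inter> {s\<in>S. \<Gamma> s \<subseteq> V} \<subseteq> {s\<in>S. \<forall>a\<in>\<Gamma> s. (s, a) \<in> W}"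
    using UV by blast
  ultimately show "\<exists>T. openin (top_of_set S) T \<and> s \<in> T \<and> T \<subseteq> {s\<in>S. \<forall>a\<in>\<Gamma> s. (s, a) \<in> W}"
    using s U(2) V(2) by blast
qed

lemma bellman_admissible:
  assumes f: "admissible f"
  shows "admissible (bellman f)"
  unfolding admissible_def
proof
  show "usc_on S (bellman f)"
    unfolding usc_on_def
  proof
    fix t
    \<comment> \<open>Because the supremum is attained, lying strictly below \<open>t\<close> is the
      same as every feasible value lying strictly below \<open>t\<close>.\<close>
    have eq: "{s\<in>S. bellman f s < t} = {s\<in>S. \<forall>a\<in>\<Gamma> s. (s, a) \<in> {x\<in>S \<times> A. action_value f x < t}}"
    proof (intro Collect_cong conj_cong refl)
      fix s assume s: "s \<in> S"
      obtain a where "a \<in> \<Gamma> s" "bellman f s = action_value f (s, a)"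
          "\<And>b. b \<in> \<Gamma> s \<Longrightarrow> action_value f (s, b) \<le> bellman f s"
        using bellman_attained[OF f s] by metis
      then show "bellman f s < t \<longleftrightarrow> (\<forall>a\<in>\<Gamma> s. (s, a) \<in> {x\<in>S \<times> A. action_value f x < t})"
        using s feasible_subset[OF s] by (auto intro: order_le_less_trans)
    qed
    show "openin (top_of_set S) {s\<in>S. bellman f s < t}"
      unfolding eq using action_value_usc[OF f] unfolding usc_on_def
      by (intro feasible_graph_open) blast
  qed
  obtain B where "\<And>s. s \<in> S \<Longrightarrow> \<bar>f s\<bar> \<le> B"
    using admissible_bound[OF f] by metis
  then obtain C where C: "\<And>x. x \<in> S \<times> A \<Longrightarrow> \<bar>action_value f x\<bar> \<le> C"
    using action_value_bound[OF admissible_measurable[OF f]] by metis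
  have "\<bar>bellman f s\<bar> \<le> C" if "s \<in> S" for s
    using bellman_attained[OF f that] feasible_subset[OF that] C that by (metis SigmaI subsetD)
  then show "bounded (bellman f ` S)"
    by (auto simp: bounded_iff)
qed

text \<open>Blackwell's monotonicity and discounting conditions in one estimate: a constant added to
  the continuation value returns multiplied by \<open>\<beta>\<close>, since \<open>p\<close> has
  total mass one.\<close>

lemma bellman_le_shift:
  assumes f: "admissible f" and g: "admissible g"
    and le: "\<And>s. s \<in> S \<Longrightarrow> f s \<le> g s + d" and s: "s \<in> S"
  shows "bellman f s \<le> bellman g s + \<beta> * d"
proof -
  obtain a where a: "a \<in> \<Gamma> s" "bellman f s = action_value f (s, a)"
    using bellman_attained[OF f s] by metis
  have x: "(s, a) \<in> S \<times> A"
    using a(1) s feasible_subset by blast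
  interpret prob_space "p (s, a)"
    using x by (rule kernel_at)
  have int: "integrable (p (s, a)) f" "integrable (p (s, a)) g"
    using kernel_integrable[OF x] admissible_measurable admissible_bound f g by metis+
  then have "(LINT s'|p (s, a). f s') \<le> (LINT s'|p (s, a). g s' + d)"
    using le kernel_at(3)[OF x] by (intro integral_mono) auto
  also have "\<dots> = (LINT s'|p (s, a). g s') + d"
    using int by (simp add: prob_space)
  finally have "action_value f (s, a) \<le> action_value g (s, a) + \<beta> * d"
    using discount(1) by (simp add: action_value_def distrib_left[symmetric])
  also have "action_value g (s, a) \<le> bellman g s"
    using bellman_attained[OF g s] a(1) by metis
  finally show ?thesis
    using a(2) by simp
qed

lemma bellman_contraction:
  assumes "admissible f" "admissible g" "\<And>s. s \<in> S \<Longrightarrow> \<bar>f s - g s\<bar> \<le> d" "s \<in> S"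
  shows "\<bar>bellman f s - bellman g s\<bar> \<le> \<beta> * d"
proof -
  have "bellman f s \<le> bellman g s + \<beta> * d"
    using assms by (intro bellman_le_shift) (auto simp: abs_le_iff algebra_simps)
  moreover have "bellman g s \<le> bellman f s + \<beta> * d"
    using assms by (intro bellman_le_shift) (auto simp: abs_le_iff algebra_simps)
  ultimately show ?thesis
    by linarith
qed

lemma bellman_selector:
  assumes f: "admissible f"
  obtains \<phi> where "\<phi> \<in> borel_on S \<rightarrow>\<^sub>M borel_on A"
    "\<And>s. s \<in> S \<Longrightarrow> \<phi> s \<in> \<Gamma> s" "\<And>s. s \<in> S \<Longrightarrow> action_value f (s, \<phi> s) = bellman f s"
proof -
  let ?w = "\<lambda>s a. action_value f (s, a)"
  have sp: "space (borel_on S) = S"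
    by (simp add: space_restrict_space)
  have usc: "usc_on (\<Gamma> s) (?w s)" if s: "s \<in> S" for s
    using usc_on_section[OF action_value_usc[OF f] s] feasible_subset[OF s] by (rule usc_on_subset)
  have meas: "{s\<in>space (borel_on S). \<exists>a\<in>\<Gamma> s \<inter> C. t \<le> ?w s a} \<in> sets (borel_on S)" if C: "closed C" for C t
  proof -
    \<comment> \<open>The threshold condition fails at \<open>s\<close> when every feasible action
      has value below \<open>t\<close> or lies outside \<open>C\<close>. Both alternatives are
      relatively open, so the failure set is open in \<open>S\<close>.\<close>
    let ?W = "{x\<in>S \<times> A. action_value f x < t} \<union> (S \<times> A) \<inter> (UNIV \<times> - C)"
    have "openin (top_of_set (S \<times> A)) ?W"
      using action_value_usc[OF f] C
      by (intro openin_Un openin_open_Int open_Times) (auto simp: usc_on_def)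
    from feasible_graph_open[OF this]
    obtain U where U: "open U" "{s\<in>S. \<forall>a\<in>\<Gamma> s. (s, a) \<in> ?W} = S \<inter> U"
      unfolding openin_open by (elim exE conjE)
    have "{s\<in>space (borel_on S). \<exists>a\<in>\<Gamma> s \<inter> C. t \<le> ?w s a} = S - {s\<in>S. \<forall>a\<in>\<Gamma> s. (s, a) \<in> ?W}"
      using feasible_subset by (auto simp: sp not_less)
    also have "\<dots> = S \<inter> - U"
      using U(2) by blast
    finally show ?thesis
      using U(1) by (auto simp: sets_restrict_space)
  qed
  define G where "G s = {a\<in>\<Gamma> s. \<forall>b\<in>\<Gamma> s. ?w s b \<le> ?w s a}" for s
  note G = argmax_hit_measurable[where M = "borel_on S" and F = \<Gamma> and w = ?w, unfolded sp,
      OF feasible_compact feasible_nonempty usc meas[unfolded sp] G_def]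
  obtain \<phi> where \<phi>: "\<phi> \<in> borel_measurable (borel_on S)" "\<And>s. s \<in> S \<Longrightarrow> \<phi> s \<in> G s"
    using measurable_selection[where M = "borel_on S" and F = G, unfolded sp, OF G] by metis
  have feas: "\<phi> s \<in> \<Gamma> s" if "s \<in> S" for s
    using \<phi>(2)[OF that] by (simp add: G_def)
  show thesis
  proof (rule that[of \<phi>])
    show "\<phi> \<in> borel_on S \<rightarrow>\<^sub>M borel_on A"
      using \<phi>(1) feas feasible_subset by (intro measurable_restrict_space2) (auto simp: sp)
    show "\<phi> s \<in> \<Gamma> s" if "s \<in> S" for s
      using feas that .
    show "?w s (\<phi> s) = bellman f s" if "s \<in> S" for s
      using bellman_attained[OF f that] \<phi>(2)[OF that] by (metis (mono_tags, lifting) G_def mem_Collect_eq order_antisym)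
  qed
qed

end

section \<open>Payoffs of strategies\<close>

locale controlled_process = discounted_program S A \<Gamma> p r \<beta>
  for S :: "(real ^ 'n) set" and A :: "(real ^ 'k) set" and \<Gamma> p r \<beta> +
  fixes \<sigma> :: "(real ^ 'n, real ^ 'k) strategy" and s :: "real ^ 'n"
  assumes strategy: "\<sigma> \<in> strategies S A \<Gamma>" and initial: "s \<in> S"
begin

sublocale IT: Ionescu_Tulcea "step_law S A p \<sigma> s" "\<lambda>_. borel_on (S \<times> A)"
  using Ionescu_Tulcea_step_law strategy initial .

abbreviation "P \<equiv> process S A p \<sigma> s"

lemma process_eq: "P = IT.PF.lim"
  by (simp add: process_def)

sublocale prob_space P
  unfolding process_eq by (rule IT.prob_space_lim)

lemma sets_process[measurable_cong]: "sets P = sets (PiM UNIV (\<lambda>_. borel_on (S \<times> A)))"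
  by (simp add: process_eq)

lemma space_process: "space P = (\<Pi>\<^sub>E t\<in>UNIV. S \<times> A)"
  by (simp add: process_eq space_PiM space_restrict_space)

lemma component_measurable[measurable]: "(\<lambda>\<omega>. \<omega> t) \<in> P \<rightarrow>\<^sub>M borel_on (S \<times> A)"
  by (simp cong: measurable_cong_sets add: sets_process)

lemma component_in: "\<omega> \<in> space P \<Longrightarrow> \<omega> t \<in> S \<times> A"
  by (auto simp: space_process)

lemma history_in: "\<omega> \<in> space P \<Longrightarrow> restrict \<omega> {0..<t} \<in> space (PiM {0..<t} (\<lambda>_. borel_on (S \<times> A)))"
  by (auto simp: space_process space_PiM space_restrict_space)

lemma
  fixes g :: "(real ^ 'n) \<times> (real ^ 'k) \<Rightarrow> real"
  assumes g[measurable]: "g \<in> borel_measurable (borel_on (S \<times> A))" and B: "\<And>x. x \<in> S \<times> A \<Longrightarrow> \<bar>g x\<bar> \<le> B"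
  shows integrable_component: "integrable P (\<lambda>\<omega>. g (\<omega> t))"
    and abs_expectation_component_le: "\<bar>expectation (\<lambda>\<omega>. g (\<omega> t))\<bar> \<le> B"
proof -
  have "(\<lambda>\<omega>. g (\<omega> t)) \<in> borel_measurable P"
    by measurable
  from abs_expectation_le[OF this] show "integrable P (\<lambda>\<omega>. g (\<omega> t))" "\<bar>expectation (\<lambda>\<omega>. g (\<omega> t))\<bar> \<le> B"
    using B component_in by blast+
qed

lemma expectation_component:
  fixes g :: "(real ^ 'n) \<times> (real ^ 'k) \<Rightarrow> real"
  assumes g: "g \<in> borel_measurable (borel_on (S \<times> A))" and "\<And>x. x \<in> S \<times> A \<Longrightarrow> \<bar>g x\<bar> \<le> B"
  shows "expectation (\<lambda>\<omega>. g (\<omega> t)) =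
    expectation (\<lambda>\<omega>. LINT s'|state_law s t (restrict \<omega> {0..<t}). g (s', \<sigma> t (restrict \<omega> {0..<t}) s'))"
proof -
  have "expectation (\<lambda>\<omega>. g (\<omega> t)) =
      expectation (\<lambda>\<omega>. LINT x|step_law S A p \<sigma> s t (restrict \<omega> {0..<t}). g x)"
    unfolding process_eq using assms
    by (intro IT.integral_lim_component[where B = B]) (auto simp: space_restrict_space)
  also have "\<dots> = expectation (\<lambda>\<omega>. LINT s'|state_law s t (restrict \<omega> {0..<t}). g (s', \<sigma> t (restrict \<omega> {0..<t}) s'))"
    using history_in by (intro Bochner_Integration.integral_cong refl integral_step_law strategy initial g)
  finally show ?thesis .
qed

lemma integrable_history:
  fixes g :: "(real ^ 'n) \<times> (real ^ 'k) \<Rightarrow> real"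
  assumes g: "g \<in> borel_measurable (borel_on (S \<times> A))" and B: "\<And>x. x \<in> S \<times> A \<Longrightarrow> \<bar>g x\<bar> \<le> B"
  shows "\<And>h. h \<in> space (PiM {0..<t} (\<lambda>_. borel_on (S \<times> A))) \<Longrightarrow> integrable (state_law s t h) (\<lambda>s'. g (s', \<sigma> t h s'))"
    and "integrable P (\<lambda>\<omega>. LINT s'|state_law s t (restrict \<omega> {0..<t}). g (s', \<sigma> t (restrict \<omega> {0..<t}) s'))"
proof -
  let ?H = "PiM {0..<t} (\<lambda>_. borel_on (S \<times> A))"
  have bound: "\<bar>g (s', \<sigma> t h s')\<bar> \<le> B" if "h \<in> space ?H" "s' \<in> S" for h s'
    using measurable_space[OF strategy_section_measurable[OF strategy that(1)], of s'] that(2) B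
    by (simp add: space_restrict_space)
  have law_integral: "integrable (state_law s t h) (\<lambda>s'. g (s', \<sigma> t h s')) \<and>
      \<bar>LINT s'|state_law s t h. g (s', \<sigma> t h s')\<bar> \<le> B" if h: "h \<in> space ?H" for h
  proof -
    note law = state_law_at[OF initial h]
    interpret L: prob_space "state_law s t h"
      by (rule law)
    have "(\<lambda>s'. g (s', \<sigma> t h s')) \<in> borel_measurable (borel_on S)"
      using measurable_compose[OF strategy_section_measurable[OF strategy h] g] .
    then have "(\<lambda>s'. g (s', \<sigma> t h s')) \<in> borel_measurable (state_law s t h)"
      using law(2) by (simp cong: measurable_cong_sets)
    moreover have "\<bar>g (s', \<sigma> t h s')\<bar> \<le> B" if "s' \<in> space (state_law s t h)" for s'
      using bound[OF h] that law(3) by simp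
    ultimately show ?thesis
      using L.abs_expectation_le by blast
  qed
  then show "\<And>h. h \<in> space ?H \<Longrightarrow> integrable (state_law s t h) (\<lambda>s'. g (s', \<sigma> t h s'))"
    by blast
  \<comment> \<open>In the inner integral the history enters both through the law and through the
    action. Measurability is therefore taken from the kernel \<open>step_law\<close> and then
    transferred by \<open>integral_step_law\<close>.\<close>
  have "(\<lambda>h. LINT x|step_law S A p \<sigma> s t h. g x) \<in> borel_measurable ?H"
    using measurable_compose[OF IT.P integral_measurable_subprob_algebra[OF g]] .
  moreover have "(\<lambda>\<omega>. restrict \<omega> {0..<t}) \<in> P \<rightarrow>\<^sub>M ?H"
    by (subst measurable_cong_sets[OF sets_process refl]) (intro measurable_restrict_subset; simp)
  ultimately have "(\<lambda>\<omega>. LINT x|step_law S A p \<sigma> s t (restrict \<omega> {0..<t}). g x) \<in> borel_measurable P"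
    by (rule measurable_compose[rotated])
  then have meas: "(\<lambda>\<omega>. LINT s'|state_law s t (restrict \<omega> {0..<t}). g (s', \<sigma> t (restrict \<omega> {0..<t}) s')) \<in> borel_measurable P"
    by (rule measurable_cong[THEN iffD1, rotated])
       (intro integral_step_law strategy initial g history_in)
  have "\<bar>LINT s'|state_law s t (restrict \<omega> {0..<t}). g (s', \<sigma> t (restrict \<omega> {0..<t}) s')\<bar> \<le> B"
    if "\<omega> \<in> space P" for \<omega>
    using law_integral[OF history_in[OF that]] by blast
  from abs_expectation_le(1)[OF meas this]
  show "integrable P (\<lambda>\<omega>. LINT s'|state_law s t (restrict \<omega> {0..<t}). g (s', \<sigma> t (restrict \<omega> {0..<t}) s'))" .
qed

text \<open>Conditionally on the past, the pair at time \<open>t\<close> has the form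
  \<open>(s', \<sigma> t h s')\<close>, so comparing on such pairs suffices. The bound of action
  values by the Bellman value is available at feasible actions, not on all of
  \<open>S \<times> A\<close>.\<close>

lemma expectation_component_mono:
  fixes g k :: "(real ^ 'n) \<times> (real ^ 'k) \<Rightarrow> real"
  assumes g: "g \<in> borel_measurable (borel_on (S \<times> A))" "\<And>x. x \<in> S \<times> A \<Longrightarrow> \<bar>g x\<bar> \<le> B"
    and k: "k \<in> borel_measurable (borel_on (S \<times> A))" "\<And>x. x \<in> S \<times> A \<Longrightarrow> \<bar>k x\<bar> \<le> C"
    and le: "\<And>h s'. h \<in> {0..<t} \<rightarrow>\<^sub>E S \<times> A \<Longrightarrow> s' \<in> S \<Longrightarrow> g (s', \<sigma> t h s') \<le> k (s', \<sigma> t h s')"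
  shows "expectation (\<lambda>\<omega>. g (\<omega> t)) \<le> expectation (\<lambda>\<omega>. k (\<omega> t))"
proof -
  let ?I = "\<lambda>f \<omega>. LINT s'|state_law s t (restrict \<omega> {0..<t}). f (s', \<sigma> t (restrict \<omega> {0..<t}) s')"
  have "expectation (\<lambda>\<omega>. g (\<omega> t)) = expectation (?I g)"
    by (rule expectation_component[OF g])
  also have "\<dots> \<le> expectation (?I k)"
  proof (rule integral_mono[OF integrable_history(2)[OF g] integrable_history(2)[OF k]])
    fix \<omega> assume "\<omega> \<in> space P"
    note h = history_in[OF this, of t]
    show "?I g \<omega> \<le> ?I k \<omega>"
    proof (rule integral_mono[OF integrable_history(1)[OF g h] integrable_history(1)[OF k h]])
      fix s' assume "s' \<in> space (state_law s t (restrict \<omega> {0..<t}))"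
      then show "g (s', \<sigma> t (restrict \<omega> {0..<t}) s') \<le> k (s', \<sigma> t (restrict \<omega> {0..<t}) s')"
        using h state_law_at(3)[OF initial h] by (intro le) (simp_all add: space_PiM space_restrict_space)
    qed
  qed
  also have "\<dots> = expectation (\<lambda>\<omega>. k (\<omega> t))"
    by (rule expectation_component[OF k, symmetric])
  finally show ?thesis .
qed

lemma
  fixes f :: "real ^ 'n \<Rightarrow> real"
  assumes f: "f \<in> borel_measurable (borel_on S)" "\<And>s. s \<in> S \<Longrightarrow> \<bar>f s\<bar> \<le> B"
  shows expectation_initial_state: "expectation (\<lambda>\<omega>. f (fst (\<omega> 0))) = f s"
    and expectation_next_state:
      "expectation (\<lambda>\<omega>. f (fst (\<omega> (Suc t)))) = expectation (\<lambda>\<omega>. LINT s'|p (\<omega> t). f s')"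
proof -
  have g: "(\<lambda>x. f (fst x)) \<in> borel_measurable (borel_on (S \<times> A))"
    using measurable_compose[OF measurable_fst_borel_on f(1)] .
  have B: "\<bar>f (fst x)\<bar> \<le> B" if "x \<in> S \<times> A" for x
    using f(2) that by auto
  note eq = expectation_component[OF g B, simplified]
  show "expectation (\<lambda>\<omega>. f (fst (\<omega> 0))) = f s"
    unfolding eq[of 0] using f(1) initial
    by (simp add: state_law_def integral_return space_restrict_space prob_space)
  show "expectation (\<lambda>\<omega>. f (fst (\<omega> (Suc t)))) = expectation (\<lambda>\<omega>. LINT s'|p (\<omega> t). f s')"
    unfolding eq[of "Suc t"] by (simp add: state_law_def)
qed

text \<open>Domination by the geometric terms \<open>\<beta> ^ t * R\<close> lets sum and
  expectation be exchanged, so that the payoff depends on the path law through its one-date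
  marginals.\<close>

lemma payoff_sums:
  "summable (\<lambda>t. \<beta> ^ t * expectation (\<lambda>\<omega>. r (\<omega> t)))"
  "payoff S A p r \<beta> \<sigma> s = (\<Sum>t. \<beta> ^ t * expectation (\<lambda>\<omega>. r (\<omega> t)))"
proof -
  obtain R where R: "\<And>x. x \<in> S \<times> A \<Longrightarrow> \<bar>r x\<bar> \<le> R"
    using payoff_bound by metis
  have geo: "summable (\<lambda>t. \<beta> ^ t * R)"
    using discount by (intro summable_mult2 summable_geometric) auto
  have "norm (\<beta> ^ t * expectation (\<lambda>\<omega>. r (\<omega> t))) \<le> \<beta> ^ t * R" for t
    using abs_expectation_component_le[OF payoff_measurable R] discount by (simp add: abs_mult mult_left_mono)
  then show "summable (\<lambda>t. \<beta> ^ t * expectation (\<lambda>\<omega>. r (\<omega> t)))"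
    by (intro summable_comparison_test'[OF geo])
  have int: "integrable P (\<lambda>\<omega>. \<beta> ^ t * r (\<omega> t))" for t
    by (intro integrable_mult_right integrable_component[OF payoff_measurable R])
  have R': "norm (\<beta> ^ t * r (\<omega> t)) \<le> \<beta> ^ t * R" if "\<omega> \<in> space P" for t \<omega>
    using R[OF component_in[OF that]] discount by (simp add: abs_mult mult_left_mono)
  have "(\<integral>\<omega>. norm (\<beta> ^ t * r (\<omega> t)) \<partial>P) \<le> \<beta> ^ t * R" for t
  proof -
    have "(\<integral>\<omega>. norm (\<beta> ^ t * r (\<omega> t)) \<partial>P) \<le> (\<integral>\<omega>. \<beta> ^ t * R \<partial>P)"
      using int R' by (intro integral_mono integrable_norm) auto
    then show ?thesis
      by (simp add: prob_space)
  qed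
  then have "summable (\<lambda>t. \<integral>\<omega>. norm (\<beta> ^ t * r (\<omega> t)) \<partial>P)"
    by (intro summable_comparison_test'[OF geo]) simp
  moreover have "AE \<omega> in P. summable (\<lambda>t. norm (\<beta> ^ t * r (\<omega> t)))"
    using R' by (intro AE_I2 summable_comparison_test'[OF geo]) simp
  ultimately have "payoff S A p r \<beta> \<sigma> s = (\<Sum>t. \<integral>\<omega>. \<beta> ^ t * r (\<omega> t) \<partial>P)"
    unfolding payoff_def using int by (intro integral_suminf)
  then show "payoff S A p r \<beta> \<sigma> s = (\<Sum>t. \<beta> ^ t * expectation (\<lambda>\<omega>. r (\<omega> t)))"
    by simp
qed

text \<open>The verification argument in both directions. Averaged over paths, the one-step
  comparison becomes the recursion of \<open>discounted_sum_le\<close>, with expected payoffs as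
  \<open>x\<close> and expected values of \<open>f\<close> at the current state as
  \<open>y\<close>.\<close>

lemma
  assumes f: "admissible f"
  shows payoff_le: "(\<And>t h s'. h \<in> {0..<t} \<rightarrow>\<^sub>E S \<times> A \<Longrightarrow> s' \<in> S \<Longrightarrow> action_value f (s', \<sigma> t h s') \<le> f s' + \<delta>) \<Longrightarrow>
      payoff S A p r \<beta> \<sigma> s \<le> f s + \<delta> / (1 - \<beta>)"
    and payoff_ge: "(\<And>t h s'. h \<in> {0..<t} \<rightarrow>\<^sub>E S \<times> A \<Longrightarrow> s' \<in> S \<Longrightarrow> f s' - \<delta> \<le> action_value f (s', \<sigma> t h s')) \<Longrightarrow>
      f s - \<delta> / (1 - \<beta>) \<le> payoff S A p r \<beta> \<sigma> s"
proof -
  note fm = admissible_measurable[OF f]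
  obtain B where B: "\<And>s. s \<in> S \<Longrightarrow> \<bar>f s\<bar> \<le> B"
    using admissible_bound[OF f] by metis
  obtain C where C: "\<And>x. x \<in> S \<times> A \<Longrightarrow> \<bar>action_value f x\<bar> \<le> C"
    using action_value_bound[OF fm B] by metis
  obtain R where R: "\<And>x. x \<in> S \<times> A \<Longrightarrow> \<bar>r x\<bar> \<le> R"
    using payoff_bound by metis
  have av: "action_value f \<in> borel_measurable (borel_on (S \<times> A))"
    using usc_on_borel_measurable[OF action_value_usc[OF f]] .
  have int_m: "(\<lambda>x. LINT s'|p x. f s') \<in> borel_measurable (borel_on (S \<times> A))"
    using measurable_compose[OF measurable_prob_algebraD[OF kernel] integral_measurable_subprob_algebra[OF fm]] .
  have fst_m: "(\<lambda>x. f (fst x) + d) \<in> borel_measurable (borel_on (S \<times> A))" for d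
    by (intro borel_measurable_add borel_measurable_const measurable_compose[OF measurable_fst_borel_on fm])
  have fst_B: "\<bar>f (fst x) + d\<bar> \<le> B + \<bar>d\<bar>" if "x \<in> S \<times> A" for x d
    using B[of "fst x"] that by auto
  let ?x = "\<lambda>t. expectation (\<lambda>\<omega>. r (\<omega> t))" and ?y = "\<lambda>t. expectation (\<lambda>\<omega>. f (fst (\<omega> t)))"
  have y: "\<bar>?y t\<bar> \<le> B" for t
    using abs_expectation_component_le[OF fst_m[of 0]] B by auto
  have shift: "expectation (\<lambda>\<omega>. f (fst (\<omega> t)) + d) = ?y t + d" for t d
    using integrable_component[OF fst_m[of 0] fst_B[of _ 0], of t] by (simp add: prob_space)
  \<comment> \<open>The continuation part of \<open>action_value f\<close> integrates
    \<open>f\<close> against the conditional law of the state at time \<open>Suc t\<close>.\<close>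
  have split: "expectation (\<lambda>\<omega>. action_value f (\<omega> t)) = ?x t + \<beta> * ?y (Suc t)" for t
  proof -
    have "expectation (\<lambda>\<omega>. action_value f (\<omega> t)) = ?x t + \<beta> * expectation (\<lambda>\<omega>. LINT s'|p (\<omega> t). f s')"
      unfolding action_value_def
      using integrable_component[OF payoff_measurable R] integrable_component[OF int_m kernel_integral_abs_le[OF _ fm B]]
      by simp
    also have "expectation (\<lambda>\<omega>. LINT s'|p (\<omega> t). f s') = ?y (Suc t)"
      by (rule expectation_next_state[OF fm B, symmetric])
    finally show ?thesis .
  qed
  have y0: "?y 0 = f s"
    by (rule expectation_initial_state[OF fm B])
  {
    assume le: "\<And>t h s'. h \<in> {0..<t} \<rightarrow>\<^sub>E S \<times> A \<Longrightarrow> s' \<in> S \<Longrightarrow> action_value f (s', \<sigma> t h s') \<le> f s' + \<delta>"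
    have "?x t + \<beta> * ?y (Suc t) \<le> ?y t + \<delta>" for t
      unfolding split[symmetric] shift[symmetric]
      using le by (intro expectation_component_mono[OF av C fst_m fst_B]) auto
    from discounted_sum_le[OF discount payoff_sums(1) y this]
    show "payoff S A p r \<beta> \<sigma> s \<le> f s + \<delta> / (1 - \<beta>)"
      by (simp add: payoff_sums(2) y0)
  }
  {
    assume ge: "\<And>t h s'. h \<in> {0..<t} \<rightarrow>\<^sub>E S \<times> A \<Longrightarrow> s' \<in> S \<Longrightarrow> f s' - \<delta> \<le> action_value f (s', \<sigma> t h s')"
    have "?y t + - \<delta> \<le> ?x t + \<beta> * ?y (Suc t)" for t
      unfolding split[symmetric] shift[symmetric]
      using ge by (intro expectation_component_mono[OF fst_m fst_B av C]) auto
    \<comment> \<open>Changing the sign of payoffs and values turns the lower estimate into an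
      instance of the upper one.\<close>
    then have step: "- ?x t + \<beta> * - ?y (Suc t) \<le> - ?y t + \<delta>" for t
      by (simp add: algebra_simps)
    have "summable (\<lambda>t. \<beta> ^ t * - ?x t)" "\<And>t. \<bar>- ?y t\<bar> \<le> B"
      using summable_minus[OF payoff_sums(1)] y by auto
    from discounted_sum_le[OF discount this step]
    show "f s - \<delta> / (1 - \<beta>) \<le> payoff S A p r \<beta> \<sigma> s"
      using suminf_minus[OF payoff_sums(1)] by (simp add: payoff_sums(2) y0)
  }
qed

end

section \<open>Convergence of value iteration to the value function\<close>

context discounted_program
begin

lemma optimal_value_near:
  assumes f: "admissible f" and near: "\<And>s. s \<in> S \<Longrightarrow> \<bar>bellman f s - f s\<bar> \<le> \<delta>" and s: "s \<in> S"
  shows "\<bar>optimal_value s - f s\<bar> \<le> \<delta> / (1 - \<beta>)"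
proof -
  have upper: "payoff S A p r \<beta> \<sigma> s \<le> f s + \<delta> / (1 - \<beta>)" if \<sigma>: "\<sigma> \<in> strategies S A \<Gamma>" for \<sigma>
  proof -
    interpret controlled_process S A \<Gamma> p r \<beta> \<sigma> s
      using \<sigma> s by unfold_locales
    show ?thesis
    proof (rule payoff_le[OF f])
      fix t :: nat and h s' assume "h \<in> {0..<t} \<rightarrow>\<^sub>E S \<times> A" and s': "s' \<in> S"
      then have "\<sigma> t h s' \<in> \<Gamma> s'"
        using \<sigma> by (simp add: strategies_def)
      then have "action_value f (s', \<sigma> t h s') \<le> bellman f s'"
        using bellman_attained[OF f s'] by metis
      with near[OF s'] show "action_value f (s', \<sigma> t h s') \<le> f s' + \<delta>"
        by linarith
    qed
  qed
  obtain \<phi> where \<phi>: "\<phi> \<in> borel_on S \<rightarrow>\<^sub>M borel_on A"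
    "\<And>s. s \<in> S \<Longrightarrow> \<phi> s \<in> \<Gamma> s" "\<And>s. s \<in> S \<Longrightarrow> action_value f (s, \<phi> s) = bellman f s"
    using bellman_selector[OF f] by metis
  \<comment> \<open>Used at every date regardless of the past, the selector attains
    \<open>bellman f\<close>, so \<open>near\<close> supplies the one-step inequality of
    \<open>payoff_ge\<close>.\<close>
  define \<tau> :: "(real ^ 'n, real ^ 'k) strategy" where "\<tau> = (\<lambda>t h. \<phi>)"
  have \<tau>: "\<tau> \<in> strategies S A \<Gamma>"
    using \<phi>(2) measurable_compose[OF measurable_snd \<phi>(1)] by (auto simp: strategies_def \<tau>_def case_prod_unfold)
  interpret controlled_process S A \<Gamma> p r \<beta> \<tau> s
    using \<tau> s by unfold_locales
  have "f s - \<delta> / (1 - \<beta>) \<le> payoff S A p r \<beta> \<tau> s"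
  proof (rule payoff_ge[OF f])
    show "f s' - \<delta> \<le> action_value f (s', \<tau> t h s')" if "s' \<in> S" for t h s'
      using \<phi>(3)[OF that] near[OF that] by (simp add: \<tau>_def)
  qed
  \<comment> \<open>Here \<open>upper\<close> supplies the boundedness that a supremum of reals
    requires.\<close>
  also have "\<dots> \<le> optimal_value s"
    unfolding value_fun_def using \<tau> upper by (intro cSUP_upper bdd_aboveI2)
  finally have "f s - \<delta> / (1 - \<beta>) \<le> optimal_value s" .
  moreover have "optimal_value s \<le> f s + \<delta> / (1 - \<beta>)"
    unfolding value_fun_def using \<tau> upper by (intro cSUP_least) auto
  ultimately show ?thesis
    by (simp add: abs_le_iff)
qed

abbreviation value_iterate :: "nat \<Rightarrow> real ^ 'n \<Rightarrow> real" where
  "value_iterate n \<equiv> (bellman ^^ n) (\<lambda>_. 0)"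

lemma value_iterate_admissible: "admissible (value_iterate n)"
  by (induction n) (auto intro: admissible_zero bellman_admissible)

lemma bellman_zero_bound:
  obtains R where "\<And>s. s \<in> S \<Longrightarrow> \<bar>bellman (\<lambda>_. 0) s\<bar> \<le> R"
  using admissible_bound[OF bellman_admissible[OF admissible_zero]] by metis

text \<open>The first Bellman step moves the zero function by at most \<open>R\<close>. Contraction
  bounds the step from the \<open>n\<close>-th iterate by \<open>\<beta> ^ n * R\<close>, and
  \<open>optimal_value_near\<close> contributes the division by \<open>1 - \<beta>\<close>.\<close>

lemma value_iterate_near:
  assumes R: "\<And>s. s \<in> S \<Longrightarrow> \<bar>bellman (\<lambda>_. 0) s\<bar> \<le> R" and s: "s \<in> S"
  shows "\<bar>optimal_value s - value_iterate n s\<bar> \<le> \<beta> ^ n * R / (1 - \<beta>)"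
proof -
  have "\<bar>bellman (value_iterate n) s - value_iterate n s\<bar> \<le> \<beta> ^ n * R" if "s \<in> S" for s
    using that
  proof (induction n arbitrary: s)
    case 0
    then show ?case
      using R by simp
  next
    case (Suc n)
    have "\<bar>bellman (value_iterate (Suc n)) s - bellman (value_iterate n) s\<bar> \<le> \<beta> * (\<beta> ^ n * R)"
      using Suc by (intro bellman_contraction value_iterate_admissible) auto
    then show ?case
      by (simp add: mult.assoc)
  qed
  then show ?thesis
    using s by (intro optimal_value_near value_iterate_admissible)
qed

lemma value_iterate_tendsto:
  assumes "s \<in> S"
  shows "(\<lambda>n. value_iterate n s) \<longlonglongrightarrow> optimal_value s"
proof -
  obtain R where R: "\<And>s. s \<in> S \<Longrightarrow> \<bar>bellman (\<lambda>_. 0) s\<bar> \<le> R"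
    using bellman_zero_bound by blast
  have "(\<lambda>n. \<beta> ^ n * R / (1 - \<beta>)) \<longlonglongrightarrow> 0 * R / (1 - \<beta>)"
    using discount by (intro tendsto_intros LIMSEQ_realpow_zero) auto
  then have "(\<lambda>n. \<beta> ^ n * R / (1 - \<beta>)) \<longlonglongrightarrow> 0"
    by simp
  moreover have "norm (value_iterate n s - optimal_value s) \<le> \<beta> ^ n * R / (1 - \<beta>)" for n
    using value_iterate_near[OF R assms, of n] by simp
  ultimately have "(\<lambda>n. value_iterate n s - optimal_value s) \<longlonglongrightarrow> 0"
    by (rule Lim_null_comparison[OF always_eventually[OF allI], rotated])
  then show ?thesis
    by (simp add: LIM_zero_iff)
qed

lemma optimal_value_measurable: "optimal_value \<in> borel_measurable (borel_on S)"
proof (rule borel_measurable_LIMSEQ_real)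
  show "(\<lambda>n. value_iterate n s) \<longlonglongrightarrow> optimal_value s" if "s \<in> space (borel_on S)" for s
    using that by (intro value_iterate_tendsto) (simp add: space_restrict_space)
  show "value_iterate n \<in> borel_measurable (borel_on S)" for n
    by (intro admissible_measurable value_iterate_admissible)
qed

lemma optimal_value_bound:
  obtains B where "\<And>s. s \<in> S \<Longrightarrow> \<bar>optimal_value s\<bar> \<le> B"
proof -
  obtain R where "\<And>s. s \<in> S \<Longrightarrow> \<bar>bellman (\<lambda>_. 0) s\<bar> \<le> R"
    using bellman_zero_bound by blast
  \<comment> \<open>The iterate with index \<open>0\<close> is the zero function, so its error
    estimate bounds the value function itself.\<close>
  from value_iterate_near[OF this, of _ 0]
  have "\<bar>optimal_value s\<bar> \<le> R / (1 - \<beta>)" if "s \<in> S" for s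
    using that by simp
  then show thesis
    by (rule that)
qed

end

section \<open>Joint supermodularity\<close>

text \<open>
  Joint supermodularity of \<open>f\<close> and \<open>g\<close> is what supermodularity of the function on
  \<open>X \<times> {0, 1}\<close> with slices \<open>f\<close> and \<open>g\<close> demands of two points on different levels.
\<close>

definition jointly_supermodular_on :: "'a::lattice set \<Rightarrow> ('a \<Rightarrow> real) \<Rightarrow> ('a \<Rightarrow> real) \<Rightarrow> bool" where
  "jointly_supermodular_on X f g \<longleftrightarrow> (\<forall>x\<in>X. \<forall>y\<in>X. f x + g y \<le> f (inf x y) + g (sup x y))"

lemma jointly_supermodular_onD:
  "jointly_supermodular_on X f g \<Longrightarrow> x \<in> X \<Longrightarrow> y \<in> X \<Longrightarrow> f x + g y \<le> f (inf x y) + g (sup x y)"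
  by (simp add: jointly_supermodular_on_def)

lemma supermodular_on_iff_jointly: "supermodular_on X f \<longleftrightarrow> jointly_supermodular_on X f f"
  by (simp add: supermodular_on_def jointly_supermodular_on_def add.commute)

text \<open>Supermodularity of \<open>f\<close> is added to the monotonicity of \<open>g - f\<close>
  between \<open>y\<close> and \<open>sup x y\<close>.\<close>

lemma jointly_supermodular_onI:
  assumes X: "lattice_set X" and f: "supermodular_on X f" and mono: "mono_on X (\<lambda>x. g x - f x)"
  shows "jointly_supermodular_on X f g"
  unfolding jointly_supermodular_on_def
proof (intro ballI)
  fix x y assume x: "x \<in> X" and y: "y \<in> X"
  have "f x + f y \<le> f (sup x y) + f (inf x y)"
    using f x y by (simp add: supermodular_on_def)
  moreover have "g y - f y \<le> g (sup x y) - f (sup x y)"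
    using mono_onD[OF mono y, of "sup x y"] X x y by (simp add: lattice_set_def)
  ultimately show "f x + g y \<le> f (inf x y) + g (sup x y)"
    by linarith
qed

text \<open>At comparable points, with \<open>f\<close> taken at the larger and \<open>g\<close> at
  the smaller one, the joint inequality is monotonicity of the difference. This is the form on which
  an increasing kernel acts.\<close>

lemma jointly_supermodular_on_mono_diff:
  assumes "jointly_supermodular_on X f g"
  shows "mono_on X (\<lambda>x. g x - f x)"
proof (rule mono_onI)
  fix x y assume "x \<in> X" "y \<in> X" "x \<le> y"
  then show "g x - f x \<le> g y - f y"
    using jointly_supermodular_onD[OF assms, of y x] by (simp add: inf_absorb2 sup_absorb1)
qed

lemma jointly_supermodular_on_LIMSEQ:
  assumes X: "lattice_set X" and js: "\<And>n. jointly_supermodular_on X (f n) (g n)"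
    and f: "\<And>x. x \<in> X \<Longrightarrow> (\<lambda>n. f n x) \<longlonglongrightarrow> f' x" and g: "\<And>x. x \<in> X \<Longrightarrow> (\<lambda>n. g n x) \<longlonglongrightarrow> g' x"
  shows "jointly_supermodular_on X f' g'"
  unfolding jointly_supermodular_on_def
proof (intro ballI)
  fix x y assume x: "x \<in> X" and y: "y \<in> X"
  then have "inf x y \<in> X" "sup x y \<in> X"
    using X by (auto simp: lattice_set_def)
  with x y show "f' x + g' y \<le> f' (inf x y) + g' (sup x y)"
    using jointly_supermodular_onD[OF js x y]
    by (intro LIMSEQ_le[OF tendsto_add[OF f g] tendsto_add[OF f g]]) auto
qed

lemma mono_on_LIMSEQ:
  fixes f :: "nat \<Rightarrow> 'a::order \<Rightarrow> real"
  assumes "\<And>n. mono_on X (f n)" and "\<And>x. x \<in> X \<Longrightarrow> (\<lambda>n. f n x) \<longlonglongrightarrow> f' x"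
  shows "mono_on X f'"
proof (rule mono_onI)
  fix x y assume xy: "x \<in> X" "y \<in> X" "x \<le> y"
  then show "f' x \<le> f' y"
    using mono_onD[OF assms(1) xy] by (intro LIMSEQ_le[OF assms(2) assms(2)]) auto
qed

lemma lattice_set_Times:
  "lattice_set X \<Longrightarrow> lattice_set Y \<Longrightarrow> lattice_set (X \<times> Y)"
  by (auto simp: lattice_set_def)

text \<open>A maximiser for \<open>v\<close> at \<open>x\<close> and one for \<open>w\<close> at
  \<open>y\<close> have a meet feasible at \<open>inf x y\<close> and a join feasible at
  \<open>sup x y\<close>. Taking \<open>v = w\<close> gives preservation of plain
  supermodularity.\<close>

lemma jointly_supermodular_on_max:
  assumes js: "jointly_supermodular_on (S \<times> A) v w" and \<Gamma>: "supermodular_corr S \<Gamma>"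
    and sub: "\<And>s. s \<in> S \<Longrightarrow> \<Gamma> s \<subseteq> A" and S: "lattice_set S"
    and v: "\<And>s. s \<in> S \<Longrightarrow> \<exists>a\<in>\<Gamma> s. v' s = v (s, a)" "\<And>s a. s \<in> S \<Longrightarrow> a \<in> \<Gamma> s \<Longrightarrow> v (s, a) \<le> v' s"
    and w: "\<And>s. s \<in> S \<Longrightarrow> \<exists>a\<in>\<Gamma> s. w' s = w (s, a)" "\<And>s a. s \<in> S \<Longrightarrow> a \<in> \<Gamma> s \<Longrightarrow> w (s, a) \<le> w' s"
  shows "jointly_supermodular_on S v' w'"
  unfolding jointly_supermodular_on_def
proof (intro ballI)
  fix x y assume x: "x \<in> S" and y: "y \<in> S"
  obtain a b where a: "a \<in> \<Gamma> x" "v' x = v (x, a)" and b: "b \<in> \<Gamma> y" "w' y = w (y, b)"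
    using v(1)[OF x] w(1)[OF y] by blast
  have "inf x y \<in> S" "sup x y \<in> S" "inf a b \<in> \<Gamma> (inf x y)" "sup a b \<in> \<Gamma> (sup x y)"
    using S \<Gamma> x y a(1) b(1) by (auto simp: lattice_set_def supermodular_corr_def)
  then have "v (inf x y, inf a b) \<le> v' (inf x y)" "w (sup x y, sup a b) \<le> w' (sup x y)"
    using v(2) w(2) by auto
  moreover have "v (x, a) + w (y, b) \<le> v (inf x y, inf a b) + w (sup x y, sup a b)"
    using jointly_supermodular_onD[OF js, of "(x, a)" "(y, b)"] x y a(1) b(1) sub by auto
  ultimately show "v' x + w' y \<le> v' (inf x y) + w' (sup x y)"
    using a(2) b(2) by linarith
qed

text \<open>Passing to the meet for \<open>v\<close> and the join for \<open>w\<close> cannot lower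
  the sum of the two objectives, and neither can exceed its maximum, so both maxima are attained
  again.\<close>

lemma jointly_supermodular_on_argmax:
  assumes js: "jointly_supermodular_on (S \<times> A) v w" and \<Gamma>: "supermodular_corr S \<Gamma>"
    and sub: "\<And>s. s \<in> S \<Longrightarrow> \<Gamma> s \<subseteq> A" and s: "s \<in> S" "s' \<in> S" "s \<le> s'"
    and a: "is_arg_max (\<lambda>a. v (s, a)) (\<lambda>a. a \<in> \<Gamma> s) a"
    and b: "is_arg_max (\<lambda>a. w (s', a)) (\<lambda>a. a \<in> \<Gamma> s') b"
  shows "is_arg_max (\<lambda>a. v (s, a)) (\<lambda>a. a \<in> \<Gamma> s) (inf b a)"
    and "is_arg_max (\<lambda>a. w (s', a)) (\<lambda>a. a \<in> \<Gamma> s') (sup b a)"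
proof -
  have in_\<Gamma>: "a \<in> \<Gamma> s" "b \<in> \<Gamma> s'"
    using a b by (auto simp: is_arg_max_def)
  then have "inf a b \<in> \<Gamma> (inf s s')" "sup a b \<in> \<Gamma> (sup s s')"
    using \<Gamma> s by (auto simp: supermodular_corr_def)
  then have feas: "inf b a \<in> \<Gamma> s" "sup b a \<in> \<Gamma> s'"
    using s(3) by (auto simp: inf_absorb1 sup_absorb2 inf_commute sup_commute)
  then have "v (s, inf b a) \<le> v (s, a)" "w (s', sup b a) \<le> w (s', b)"
    using a b by (auto simp: is_arg_max_linorder)
  moreover have "v (s, a) + w (s', b) \<le> v (s, inf b a) + w (s', sup b a)"
    using jointly_supermodular_onD[OF js, of "(s, a)" "(s', b)"] in_\<Gamma> s sub
    by (auto simp: inf_absorb1 sup_absorb2 inf_commute sup_commute)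
  ultimately have "v (s, inf b a) = v (s, a)" "w (s', sup b a) = w (s', b)"
    by linarith+
  with a b feas show "is_arg_max (\<lambda>a. v (s, a)) (\<lambda>a. a \<in> \<Gamma> s) (inf b a)"
    "is_arg_max (\<lambda>a. w (s', a)) (\<lambda>a. a \<in> \<Gamma> s') (sup b a)"
    by (auto simp: is_arg_max_linorder)
qed

section \<open>Comparison of two programs with the same dynamics\<close>

lemma increasing_kernelD:
  fixes f :: "_ \<Rightarrow> real"
  assumes "increasing_kernel S A p" "mono_on S f" "f \<in> borel_measurable (borel_on S)"
    and "\<And>x. x \<in> S \<times> A \<Longrightarrow> integrable (p x) f"
  shows "mono_on (S \<times> A) (\<lambda>x. LINT s'|p x. f s')"
  using assms(2-) by (intro assms(1)[unfolded increasing_kernel_def integrable_for_kernel_def, rule_format, of f]) auto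

lemma supermodular_kernelD:
  fixes f :: "_ \<Rightarrow> real"
  assumes "supermodular_kernel S A p" "supermodular_on S f" "f \<in> borel_measurable (borel_on S)"
    and "\<And>x. x \<in> S \<times> A \<Longrightarrow> integrable (p x) f"
  shows "supermodular_on (S \<times> A) (\<lambda>x. LINT s'|p x. f s')"
  using assms(2-) by (intro assms(1)[unfolded supermodular_kernel_def integrable_for_kernel_def, rule_format, of f]) auto

text \<open>Covers both parts of the theorem: equal payoffs with ordered discount factors, and equal
  discount factors with payoffs at ordered parameters. The assumptions guarded by
  \<open>\<beta>\<^sub>1 < \<beta>\<^sub>2\<close> serve the term that a change of discount factor
  creates.\<close>

locale program_pair =
  lo: discounted_program S A \<Gamma> p r\<^sub>1 \<beta>\<^sub>1 + hi: discounted_program S A \<Gamma> p r\<^sub>2 \<beta>\<^sub>2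
  for S :: "(real ^ 'n) set" and A :: "(real ^ 'k) set" and \<Gamma> p r\<^sub>1 r\<^sub>2 \<beta>\<^sub>1 \<beta>\<^sub>2 +
  assumes lattices: "lattice_set S" "lattice_set A"
    and payoff_supermodular: "supermodular_on (S \<times> A) r\<^sub>1"
    and payoff_mono_diff: "mono_on (S \<times> A) (\<lambda>x. r\<^sub>2 x - r\<^sub>1 x)"
    and kernel_increasing: "increasing_kernel S A p"
    and kernel_supermodular: "supermodular_kernel S A p"
    and feasible_supermodular: "supermodular_corr S \<Gamma>"
    and discount_mono: "\<beta>\<^sub>1 \<le> \<beta>\<^sub>2"
    and discount_change: "\<beta>\<^sub>1 < \<beta>\<^sub>2 \<Longrightarrow> a \<in> A \<Longrightarrow> mono_on S (\<lambda>s. r\<^sub>2 (s, a))"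
      "\<beta>\<^sub>1 < \<beta>\<^sub>2 \<Longrightarrow> s \<in> S \<Longrightarrow> s' \<in> S \<Longrightarrow> s \<le> s' \<Longrightarrow> \<Gamma> s \<subseteq> \<Gamma> s'"
begin

text \<open>Stated for bounded measurable \<open>f\<close> and \<open>g\<close> because it is
  applied to the iterates and again to the value functions.\<close>

lemma
  fixes f g :: "real ^ 'n \<Rightarrow> real"
  assumes f: "f \<in> borel_measurable (borel_on S)" "\<And>s. s \<in> S \<Longrightarrow> \<bar>f s\<bar> \<le> B"
    and g: "g \<in> borel_measurable (borel_on S)" "\<And>s. s \<in> S \<Longrightarrow> \<bar>g s\<bar> \<le> C"
    and f_super: "supermodular_on S f" and js: "jointly_supermodular_on S f g"
    and mono: "\<beta>\<^sub>1 < \<beta>\<^sub>2 \<Longrightarrow> mono_on S g"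
  shows action_value_supermodular: "supermodular_on (S \<times> A) (lo.action_value f)"
    and action_value_jointly_supermodular:
      "jointly_supermodular_on (S \<times> A) (lo.action_value f) (hi.action_value g)"
    and action_value_mono: "\<beta>\<^sub>1 < \<beta>\<^sub>2 \<Longrightarrow> a \<in> A \<Longrightarrow> mono_on S (\<lambda>s. hi.action_value g (s, a))"
proof -
  have int_f: "integrable (p x) f" and int_g: "integrable (p x) g" if "x \<in> S \<times> A" for x
    using lo.kernel_integrable[OF that] f g by blast+
  have "supermodular_on (S \<times> A) (\<lambda>x. LINT s'|p x. f s')"
    by (intro supermodular_kernelD kernel_supermodular f_super f(1) int_f)
  then show super: "supermodular_on (S \<times> A) (lo.action_value f)"
    unfolding supermodular_on_def
  proof (intro ballI)
    fix x y assume K: "\<forall>x\<in>S \<times> A. \<forall>y\<in>S \<times> A. (LINT s'|p x. f s') + (LINT s'|p y. f s')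
        \<le> (LINT s'|p (sup x y). f s') + (LINT s'|p (inf x y). f s')"
      and xy: "x \<in> S \<times> A" "y \<in> S \<times> A"
    have "r\<^sub>1 x + r\<^sub>1 y \<le> r\<^sub>1 (sup x y) + r\<^sub>1 (inf x y)"
      using payoff_supermodular xy unfolding supermodular_on_def by blast
    moreover have "\<beta>\<^sub>1 * ((LINT s'|p x. f s') + (LINT s'|p y. f s'))
        \<le> \<beta>\<^sub>1 * ((LINT s'|p (sup x y). f s') + (LINT s'|p (inf x y). f s'))"
      using K[rule_format, OF xy] lo.discount by (intro mult_left_mono) auto
    ultimately show "lo.action_value f x + lo.action_value f y
        \<le> lo.action_value f (sup x y) + lo.action_value f (inf x y)"
      unfolding lo.action_value_def by (simp add: algebra_simps)
  qed
  \<comment> \<open>The kernel is applied to the single integrand \<open>g - f\<close>, whose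
    monotonicity is extracted from the joint inequality.\<close>
  have "mono_on (S \<times> A) (\<lambda>x. LINT s'|p x. g s' - f s')"
    by (intro increasing_kernelD kernel_increasing jointly_supermodular_on_mono_diff js
        borel_measurable_diff f(1) g(1) Bochner_Integration.integrable_diff int_f int_g)
  then have diff: "(LINT s'|p x. g s') - (LINT s'|p x. f s') \<le> (LINT s'|p y. g s') - (LINT s'|p y. f s')"
    if "x \<in> S \<times> A" "y \<in> S \<times> A" "x \<le> y" for x y
    using mono_onD[OF _ that] int_f int_g that by fastforce
  have incr: "(LINT s'|p x. g s') \<le> (LINT s'|p y. g s')"
    if "\<beta>\<^sub>1 < \<beta>\<^sub>2" "x \<in> S \<times> A" "y \<in> S \<times> A" "x \<le> y" for x y
  proof -
    have "mono_on (S \<times> A) (\<lambda>x. LINT s'|p x. g s')"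
      by (intro increasing_kernelD kernel_increasing mono that(1) g(1) int_g)
    from mono_onD[OF this that(2-4)] show ?thesis .
  qed
  show "jointly_supermodular_on (S \<times> A) (lo.action_value f) (hi.action_value g)"
  proof (rule jointly_supermodular_onI[OF lattice_set_Times[OF lattices] super], rule mono_onI)
    \<comment> \<open>The difference of the objectives is \<open>r\<^sub>2 - r\<^sub>1\<close>, plus
      \<open>\<beta>\<^sub>1\<close> times the integral of \<open>g - f\<close>, plus
      \<open>\<beta>\<^sub>2 - \<beta>\<^sub>1\<close> times the integral of \<open>g\<close>. Each
      summand is monotone, the last being zero for equal discount factors.\<close>
    fix x y assume xy: "x \<in> S \<times> A" "y \<in> S \<times> A" "x \<le> y"
    have "r\<^sub>2 x - r\<^sub>1 x \<le> r\<^sub>2 y - r\<^sub>1 y"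
      using mono_onD[OF payoff_mono_diff xy] .
    moreover have "\<beta>\<^sub>1 * ((LINT s'|p x. g s') - (LINT s'|p x. f s'))
        \<le> \<beta>\<^sub>1 * ((LINT s'|p y. g s') - (LINT s'|p y. f s'))"
      using diff[OF xy] lo.discount by (intro mult_left_mono) auto
    moreover have "(\<beta>\<^sub>2 - \<beta>\<^sub>1) * (LINT s'|p x. g s') \<le> (\<beta>\<^sub>2 - \<beta>\<^sub>1) * (LINT s'|p y. g s')"
      using incr[OF _ xy] discount_mono by (cases "\<beta>\<^sub>1 < \<beta>\<^sub>2") (auto intro: mult_left_mono)
    ultimately show "hi.action_value g x - lo.action_value f x \<le> hi.action_value g y - lo.action_value f y"
      unfolding hi.action_value_def lo.action_value_def by (simp add: algebra_simps)
  qed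
  show "mono_on S (\<lambda>s. hi.action_value g (s, a))" if \<beta>: "\<beta>\<^sub>1 < \<beta>\<^sub>2" and a: "a \<in> A"
  proof (rule mono_onI)
    fix s s' assume s: "s \<in> S" "s' \<in> S" "s \<le> s'"
    have "r\<^sub>2 (s, a) \<le> r\<^sub>2 (s', a)"
      using mono_onD[OF discount_change(1)[OF \<beta> a] s] .
    moreover have "\<beta>\<^sub>2 * (LINT t|p (s, a). g t) \<le> \<beta>\<^sub>2 * (LINT t|p (s', a). g t)"
      using incr[OF \<beta>, of "(s, a)" "(s', a)"] a s hi.discount by (intro mult_left_mono) auto
    ultimately show "hi.action_value g (s, a) \<le> hi.action_value g (s', a)"
      unfolding hi.action_value_def by linarith
  qed
qed

text \<open>The claims form one induction: the joint inequality for the next iterates draws on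
  supermodularity of the lower one and, when the discount factors differ, on monotonicity of the
  higher one.\<close>

lemma value_iterate_properties:
  "supermodular_on S (lo.value_iterate n)"
  "jointly_supermodular_on S (lo.value_iterate n) (hi.value_iterate n)"
  "\<beta>\<^sub>1 < \<beta>\<^sub>2 \<Longrightarrow> mono_on S (hi.value_iterate n)"
proof (induction n)
  case 0
  show "supermodular_on S (lo.value_iterate 0)"
    "jointly_supermodular_on S (lo.value_iterate 0) (hi.value_iterate 0)" "mono_on S (hi.value_iterate 0)"
    by (simp_all add: supermodular_on_def jointly_supermodular_on_def mono_on_def)
next
  case (Suc n)
  let ?f = "lo.value_iterate n" and ?g = "hi.value_iterate n"
  note f = lo.value_iterate_admissible[of n] and g = hi.value_iterate_admissible[of n]
  obtain B C where B: "\<And>s. s \<in> S \<Longrightarrow> \<bar>?f s\<bar> \<le> B" and C: "\<And>s. s \<in> S \<Longrightarrow> \<bar>?g s\<bar> \<le> C"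
    using lo.admissible_bound[OF f] hi.admissible_bound[OF g] by metis
  note av = lo.admissible_measurable[OF f] B hi.admissible_measurable[OF g] C Suc.IH
  have lo_max: "\<exists>a\<in>\<Gamma> s. lo.bellman ?f s = lo.action_value ?f (s, a)"
      "a \<in> \<Gamma> s \<Longrightarrow> lo.action_value ?f (s, a) \<le> lo.bellman ?f s" if "s \<in> S" for s a
    using lo.bellman_attained[OF f that] by metis+
  have hi_max: "\<exists>a\<in>\<Gamma> s. hi.bellman ?g s = hi.action_value ?g (s, a)"
      "a \<in> \<Gamma> s \<Longrightarrow> hi.action_value ?g (s, a) \<le> hi.bellman ?g s" if "s \<in> S" for s a
    using hi.bellman_attained[OF g that] by metis+
  have "jointly_supermodular_on S (lo.bellman ?f) (lo.bellman ?f)"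
    using action_value_supermodular[OF av] unfolding supermodular_on_iff_jointly
    by (rule jointly_supermodular_on_max[OF _ feasible_supermodular lo.feasible_subset lattices(1) lo_max lo_max])
  then show "supermodular_on S (lo.value_iterate (Suc n))"
    by (simp add: supermodular_on_iff_jointly)
  have "jointly_supermodular_on S (lo.bellman ?f) (hi.bellman ?g)"
    using action_value_jointly_supermodular[OF av]
    by (rule jointly_supermodular_on_max[OF _ feasible_supermodular lo.feasible_subset lattices(1) lo_max hi_max])
  then show "jointly_supermodular_on S (lo.value_iterate (Suc n)) (hi.value_iterate (Suc n))"
    by simp
  assume \<beta>: "\<beta>\<^sub>1 < \<beta>\<^sub>2"
  have "mono_on S (hi.bellman ?g)"
  proof (rule mono_onI)
    fix s s' assume s: "s \<in> S" "s' \<in> S" "s \<le> s'"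
    obtain a where a: "a \<in> \<Gamma> s" "hi.bellman ?g s = hi.action_value ?g (s, a)"
      using hi_max(1)[OF s(1)] by blast
    \<comment> \<open>Growth of the feasible sets keeps the maximiser at \<open>s\<close> available
      at \<open>s'\<close>.\<close>
    have "a \<in> A" "a \<in> \<Gamma> s'"
      using a(1) lo.feasible_subset[OF s(1)] discount_change(2)[OF \<beta> s] by auto
    then show "hi.bellman ?g s \<le> hi.bellman ?g s'"
      using a(2) mono_onD[OF action_value_mono[OF av \<beta>] s] hi_max(2)[OF s(2)] by fastforce
  qed
  then show "mono_on S (hi.value_iterate (Suc n))"
    by simp
qed

lemma optimal_actions_ascending:
  assumes s: "s \<in> S" "s' \<in> S" "s \<le> s'"
    and a: "a \<in> optimal_actions S A \<Gamma> p r\<^sub>1 \<beta>\<^sub>1 s" and b: "b \<in> optimal_actions S A \<Gamma> p r\<^sub>2 \<beta>\<^sub>2 s'"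
  shows "sup b a \<in> optimal_actions S A \<Gamma> p r\<^sub>2 \<beta>\<^sub>2 s'" "inf b a \<in> optimal_actions S A \<Gamma> p r\<^sub>1 \<beta>\<^sub>1 s"
proof -
  obtain B C where B: "\<And>s. s \<in> S \<Longrightarrow> \<bar>lo.optimal_value s\<bar> \<le> B" and C: "\<And>s. s \<in> S \<Longrightarrow> \<bar>hi.optimal_value s\<bar> \<le> C"
    using lo.optimal_value_bound hi.optimal_value_bound by metis
  have "jointly_supermodular_on S lo.optimal_value lo.optimal_value"
    by (rule jointly_supermodular_on_LIMSEQ[OF lattices(1)
        value_iterate_properties(1)[unfolded supermodular_on_iff_jointly]
        lo.value_iterate_tendsto lo.value_iterate_tendsto])
  then have super: "supermodular_on S lo.optimal_value"
    by (simp add: supermodular_on_iff_jointly)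
  have js: "jointly_supermodular_on S lo.optimal_value hi.optimal_value"
    by (rule jointly_supermodular_on_LIMSEQ[OF lattices(1) value_iterate_properties(2)
        lo.value_iterate_tendsto hi.value_iterate_tendsto])
  have mono: "mono_on S hi.optimal_value" if "\<beta>\<^sub>1 < \<beta>\<^sub>2"
    using value_iterate_properties(3)[OF that] hi.value_iterate_tendsto by (rule mono_on_LIMSEQ)
  note js_av = action_value_jointly_supermodular[OF lo.optimal_value_measurable B hi.optimal_value_measurable C super js mono]
  have eq: "optimal_actions S A \<Gamma> p r\<^sub>1 \<beta>\<^sub>1 s =
      {a. is_arg_max (\<lambda>a. lo.action_value lo.optimal_value (s, a)) (\<lambda>a. a \<in> \<Gamma> s) a}"
    "optimal_actions S A \<Gamma> p r\<^sub>2 \<beta>\<^sub>2 s =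
      {a. is_arg_max (\<lambda>a. hi.action_value hi.optimal_value (s, a)) (\<lambda>a. a \<in> \<Gamma> s) a}" for s
    by (simp_all add: optimal_actions_def lo.action_value_def hi.action_value_def)
  from jointly_supermodular_on_argmax[OF js_av feasible_supermodular lo.feasible_subset s a[unfolded eq mem_Collect_eq] b[unfolded eq mem_Collect_eq]]
  show "sup b a \<in> optimal_actions S A \<Gamma> p r\<^sub>2 \<beta>\<^sub>2 s'" "inf b a \<in> optimal_actions S A \<Gamma> p r\<^sub>1 \<beta>\<^sub>1 s"
    by (simp_all add: eq)
qed

end

section \<open>Ascending optimal actions under changes of discount factor and payoff\<close>

theorem theorem3p5:
  fixes S :: "(real ^ 'n) set"
    and A :: "(real ^ 'k) set"
    and \<Gamma> :: "(real ^ 'n) \<Rightarrow> (real ^ 'k) set"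
    and p :: "(real ^ 'n, real ^ 'k) kernel"
    and r :: "(real ^ 'n) \<times> (real ^ 'k) \<Rightarrow> real"
    and E :: "'e::order set"
    and rc :: "(real ^ 'n) \<times> (real ^ 'k) \<Rightarrow> 'e \<Rightarrow> real"
    and \<beta> :: real
  assumes "lattice_set A" and "lattice_set S"
  shows
    "(dynamic_program S A \<Gamma> p r \<and>
      supermodular_on (S \<times> A) r \<and>
      (\<forall>a\<in>A. mono_on S (\<lambda>s. r (s, a))) \<and>
      increasing_kernel S A p \<and> supermodular_kernel S A p \<and>
      supermodular_corr S \<Gamma> \<and>
      (\<forall>s1\<in>S. \<forall>s2\<in>S. s1 \<le> s2 \<longrightarrow> \<Gamma> s1 \<subseteq> \<Gamma> s2)
      \<longrightarrow> ascending_on (S \<times> {0<..<1}) (\<lambda>(s, b). optimal_actions S A \<Gamma> p r b s)) \<and>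
     ((\<forall>c\<in>E. dynamic_program S A \<Gamma> p (\<lambda>x. rc x c)) \<and>
      0 < \<beta> \<and> \<beta> < 1 \<and>
      (\<forall>c\<in>E. supermodular_on (S \<times> A) (\<lambda>x. rc x c)) \<and>
      increasing_differences3 S A E (\<lambda>s a c. rc (s, a) c) \<and>
      increasing_kernel S A p \<and> supermodular_kernel S A p \<and>
      supermodular_corr S \<Gamma>
      \<longrightarrow> ascending_on (S \<times> E) (\<lambda>(s, c). optimal_actions S A \<Gamma> p (\<lambda>x. rc x c) \<beta> s))"
proof (intro conjI impI)
  assume H: "dynamic_program S A \<Gamma> p r \<and> supermodular_on (S \<times> A) r \<and>
      (\<forall>a\<in>A. mono_on S (\<lambda>s. r (s, a))) \<and> increasing_kernel S A p \<and> supermodular_kernel S A p \<and>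
      supermodular_corr S \<Gamma> \<and> (\<forall>s1\<in>S. \<forall>s2\<in>S. s1 \<le> s2 \<longrightarrow> \<Gamma> s1 \<subseteq> \<Gamma> s2)"
  then interpret dynamic_program S A \<Gamma> p r
    by blast
  \<comment> \<open>With a single payoff the difference of payoffs is zero and hence
    monotone.\<close>
  have pair: "program_pair S A \<Gamma> p r r b1 b2" if "0 < b1" "b1 \<le> b2" "b2 < 1" for b1 b2
    using that H assms by unfold_locales (auto simp: mono_on_def)
  show "ascending_on (S \<times> {0<..<1}) (\<lambda>(s, b). optimal_actions S A \<Gamma> p r b s)"
    unfolding ascending_on_def
  proof (intro ballI impI)
    fix y1 y2 a' a assume y: "y1 \<in> S \<times> {0<..<1}" "y2 \<in> S \<times> {0<..<1}" "y1 \<le> y2"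
      and a': "a' \<in> (case y2 of (s, b) \<Rightarrow> optimal_actions S A \<Gamma> p r b s)"
      and a: "a \<in> (case y1 of (s, b) \<Rightarrow> optimal_actions S A \<Gamma> p r b s)"
    obtain s1 b1 s2 b2 where eq: "y1 = (s1, b1)" "y2 = (s2, b2)"
      by (metis surj_pair)
    have "program_pair S A \<Gamma> p r r b1 b2"
      using y by (intro pair) (auto simp: eq)
    from program_pair.optimal_actions_ascending[OF this, of s1 s2 a a'] y a a'
    show "sup a' a \<in> (case y2 of (s, b) \<Rightarrow> optimal_actions S A \<Gamma> p r b s) \<and>
        inf a' a \<in> (case y1 of (s, b) \<Rightarrow> optimal_actions S A \<Gamma> p r b s)"
      by (simp add: eq)
  qed
next
  assume H: "(\<forall>c\<in>E. dynamic_program S A \<Gamma> p (\<lambda>x. rc x c)) \<and> 0 < \<beta> \<and> \<beta> < 1 \<and>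
      (\<forall>c\<in>E. supermodular_on (S \<times> A) (\<lambda>x. rc x c)) \<and>
      increasing_differences3 S A E (\<lambda>s a c. rc (s, a) c) \<and>
      increasing_kernel S A p \<and> supermodular_kernel S A p \<and> supermodular_corr S \<Gamma>"
  have program: "discounted_program S A \<Gamma> p (\<lambda>x. rc x c) \<beta>" if "c \<in> E" for c
    using H that by (simp add: discounted_program_def discounted_program_axioms_def)
  have diff: "mono_on (S \<times> A) (\<lambda>x. rc x c2 - rc x c1)" if c: "c1 \<in> E" "c2 \<in> E" "c1 \<le> c2" for c1 c2
  proof (rule mono_onI)
    fix x y assume "x \<in> S \<times> A" "y \<in> S \<times> A" "x \<le> y"
    then obtain s a s' a' where xy: "x = (s, a)" "y = (s', a')"
      and in_X: "s \<in> S" "s' \<in> S" "a \<in> A" "a' \<in> A" and le: "s \<le> s'" "a \<le> a'"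
      by (auto simp: less_eq_prod_def)
    have SE: "increasing_differences S E (\<lambda>s c. rc (s, a) c)"
      and AE: "increasing_differences A E (\<lambda>a c. rc (s', a) c)"
      using H in_X unfolding increasing_differences3_def by blast+
    \<comment> \<open>Going through \<open>(s', a)\<close> changes one coordinate at a time, so
      increasing differences in state and parameter, then in action and parameter, apply in
      turn.\<close>
    have "rc (s, a) c2 - rc (s, a) c1 \<le> rc (s', a) c2 - rc (s', a) c1"
      using SE c in_X le unfolding increasing_differences_def by blast
    also have "\<dots> \<le> rc (s', a') c2 - rc (s', a') c1"
      using AE c in_X le unfolding increasing_differences_def by blast
    finally show "rc x c2 - rc x c1 \<le> rc y c2 - rc y c1"
      by (simp add: xy)
  qed
  \<comment> \<open>The discount factors coincide, so the assumptions on a strict increase of the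
    discount factor hold vacuously.\<close>
  have pair: "program_pair S A \<Gamma> p (\<lambda>x. rc x c1) (\<lambda>x. rc x c2) \<beta> \<beta>" if c: "c1 \<in> E" "c2 \<in> E" "c1 \<le> c2" for c1 c2
    using program[OF c(1)] program[OF c(2)] diff[OF c] H c assms
    by (intro program_pair.intro program_pair_axioms.intro) auto
  show "ascending_on (S \<times> E) (\<lambda>(s, c). optimal_actions S A \<Gamma> p (\<lambda>x. rc x c) \<beta> s)"
    unfolding ascending_on_def
  proof (intro ballI impI)
    fix y1 y2 a' a assume y: "y1 \<in> S \<times> E" "y2 \<in> S \<times> E" "y1 \<le> y2"
      and a': "a' \<in> (case y2 of (s, c) \<Rightarrow> optimal_actions S A \<Gamma> p (\<lambda>x. rc x c) \<beta> s)"
      and a: "a \<in> (case y1 of (s, c) \<Rightarrow> optimal_actions S A \<Gamma> p (\<lambda>x. rc x c) \<beta> s)"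
    obtain s1 c1 s2 c2 where eq: "y1 = (s1, c1)" "y2 = (s2, c2)"
      by (metis surj_pair)
    have "program_pair S A \<Gamma> p (\<lambda>x. rc x c1) (\<lambda>x. rc x c2) \<beta> \<beta>"
      using y by (intro pair) (auto simp: eq)
    from program_pair.optimal_actions_ascending[OF this, of s1 s2 a a'] y a a'
    show "sup a' a \<in> (case y2 of (s, c) \<Rightarrow> optimal_actions S A \<Gamma> p (\<lambda>x. rc x c) \<beta> s) \<and>
        inf a' a \<in> (case y1 of (s, c) \<Rightarrow> optimal_actions S A \<Gamma> p (\<lambda>x. rc x c) \<beta> s)"
      by (simp add: eq)
  qed
qed

end
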